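(* For given admissible parameters ($\mathsf R,\mathsf S\ge0$ and $\mathsf P,\mathsf k_1,\mathsf k_2>0$) and finite index sets $\mathscr N_{\mathbf u}^\tau\subset\mathscr N_{\mathbf u}$, $\mathscr N_\theta^\tau\subset\mathscr N_\theta$ satisfying the Energy Balance Criterion stated in the context, there exists a $C>0$, independent of $\mathsf R$ and $\mathsf S$, such that the Nusselt number of the truncated ODE model satisfies $$\sup_{(\mathbf u_0^\tau,\theta_0^\tau)}\mathsf{Nu}^\tau\le C\,\big(1+|\mathscr N_\theta^\tau\cap\mathscr N_\theta^*|\big)\max_{\mathbf n\in\mathscr N_\theta^\tau\cap\mathscr N_\theta^*}(m_3),$$ where the supremum is over all initial conditions of the truncated ODE model.
   Context: Domain. $\mathsf k_3=(\mathsf k_1\mathsf k_2)^{-1}$, $\Omega=[0,\frac{2\pi}{\mathsf k_1}]\times[0,\frac{2\pi}{\mathsf k_2}]\times[0,\frac{\pi}{\mathsf k_3}]$; functions are periodic in $x_1,x_2$. $\langle g\rangle=\int_\Omega g\,d\mathbf x$, $\hat{\mathbf e}^3=(0,0,1)$, $\mathcal K=\mathrm{diag}[\mathsf k_1,\mathsf k_2,\mathsf k_3]$. Indices. An index is $\mathbf n=(\mathbf m,\mathbf p,c)$ with $\mathbf m=(m_1,m_2,m_3)\in\mathbb Z_{\ge0}^3$, $\mathbf p=(p_1,p_2)\in\{0,1\}^2$, $c\in\{1,2\}$. Phase arithmetic is mod 2, $p_3:=0$. $s^{m,0}(x)=\cos(mx)$, $s^{m,1}(x)=\sin(mx)$;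 $\iota^{m}=0$ if $m=0$, $1$ if $m>0$; $\eta^{\mathbf m}=\prod_{k\le3}(\sqrt2)^{\iota^{m_k}}$; $V=(4\pi^3)^{1/2}$. Temperature modes. $\mathscr P^{m}=\{0\}$ if $m=0$ and $\{0,1\}$ if $m>0$; $\mathscr N_\theta=\{(\mathbf m,\mathbf p,1): m_1,m_2\ge0,\ m_3>0,\ \mathbf p\in\mathscr P^{m_1}\times\mathscr P^{m_2}\}$; $f^{\mathbf n}(\mathbf x)=\frac{\eta^{\mathbf m}}{V}s^{m_1,p_1}(\mathsf k_1x_1)s^{m_2,p_2}(\mathsf k_2x_2)s^{m_3,1}(\mathsf k_3x_3)$. $\mathscr N_\theta^*=\{\mathbf n\in\mathscr N_\theta: m_1=m_2=0,\ m_3>0\}$. Velocity modes. With $\boldsymbol\gamma=(1,1,-1)$: $\mathcal G^{(\mathbf m,\mathbf p,1)}=\mathrm{diag}[\boldsymbol\gamma\times\mathcal K\mathbf m]$, $\mathcal G^{(\mathbf m,\mathbf p,2)}=\mathrm{diag}[\mathcal K\mathbf m\times(\boldsymbol\gamma\times\mathcal K\mathbf m)]$, $\nu_i^{\mathbf n}=\prod_{j\le3}(\iota^{m_j})^{p_j+\delta^{i,j}}$ (exponents mod 2, $0^0=1$), $\varsigma^{\mathbf p}_{1,1}=(-1)^{p_1}$, $\varsigma^{\mathbf p}_{2,2}=(-1)^{p_2}$, $\varsigma^{\mathbf p}_{3,3}=1$, and $$v^{\mathbf n}_i(\mathbf x)=\frac{\eta^{\mathbf m}}{|\mathcal G^{\mathbf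 n}\boldsymbol\nu^{\mathbf n}|V}\mathcal G^{\mathbf n}_{i,i}\varsigma^{\mathbf p}_{i,i}\prod_{j\le3}s^{m_j,p_j+\delta^{i,j}}(\mathsf k_jx_j).$$ $\mathscr N_{\mathbf u}=\{(\mathbf m,\mathbf p,c):\mathbf m\in\mathbb Z_{\ge0}^3\setminus\{\mathbf 0\},\ \mathbf p\in\mathscr P^{\mathbf m}_{\mathbf u},\ c\in\mathscr C^{\mathbf m}_{\mathbf u}\}$, where $\mathscr P^{\mathbf m}_{\mathbf u}=\{0,1\}\times\{1\}$ if $m_1>0,m_2=m_3=0$; $\{1\}\times\{0,1\}$ if $m_2>0,m_1=m_3=0$; $\{(0,1),(1,0)\}$ if $m_3>0,m_1=m_2=0$; $\{0,1\}^2$ otherwise; $\mathscr C^{\mathbf m}_{\mathbf u}=\{1,2\}$ if all $m_k>0$, else $\{1\}$. The $f^{\mathbf n}$ are $L^2$-orthonormal; the $\mathbf v^{\mathbf n}$ are $L^2$-orthonormal, divergence-free, with $v_3^{\mathbf n}=0$ at $x_3=0,\pi/\mathsf k_3$. Truncated ODE model. For finite $\mathscr N_{\mathbf u}^\tau\subset\mathscr N_{\mathbf u}$, $\mathscr N_\theta^\tau\subset\mathscr N_\theta$ put $\mathbf u^\tau=\sum_{\mathbf n\in\mathscr N_{\mathbf u}^\tau}u^{\tau,\mathbf n}(t)\mathbf v^{\mathbf n}$, $\theta^\tau=\sum_{\mathbf n\in\mathscr N_\theta^\tau}\theta^{\tau,\mathbf n}(t)f^{\mathbf n}$, $\mathcal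 P^\tau_{\mathbf u}[\mathbf v]=\sum_{\mathbf n\in\mathscr N_{\mathbf u}^\tau}\langle\mathbf v\cdot\mathbf v^{\mathbf n}\rangle\mathbf v^{\mathbf n}$, $\mathcal P_\theta^\tau[g]=\sum_{\mathbf n\in\mathscr N_\theta^\tau}\langle gf^{\mathbf n}\rangle f^{\mathbf n}$. The model is the ODE system for the coefficients $(u^{\tau,\mathbf n},\theta^{\tau,\mathbf n})\in\mathbb R^{|\mathscr N_{\mathbf u}^\tau|}\times\mathbb R^{|\mathscr N_\theta^\tau|}$ given by $$\partial_t\mathbf u^\tau=\mathsf P\Delta\mathbf u^\tau+\mathsf P\mathsf R\,\mathcal P^\tau_{\mathbf u}[\theta^\tau\hat{\mathbf e}^3]-\mathsf P\mathsf S\,\mathcal P^\tau_{\mathbf u}[\hat{\mathbf e}^3\times\mathbf u^\tau]-\mathcal P^\tau_{\mathbf u}[\mathbf u^\tau\cdot\nabla\mathbf u^\tau],$$ $$\partial_t\theta^\tau=\Delta\theta^\tau+\mathcal P^\tau_\theta[u_3^\tau]-\mathcal P^\tau_\theta[\mathbf u^\tau\cdot\nabla\theta^\tau].$$ Solutions exist globally in time. Nusselt number. For an initial condition $(\mathbf u_0^\tau,\theta_0^\tau)$ with solution $(\mathbf u^\tau,\theta^\tau)$, $$\mathsf{Nu}^\tau=1+\frac1{4\pi^4}\lim_{t\to\infty}\frac1t\int_0^t\langle u_3^\tau\theta^\tau\rangle(s)\,ds.$$ Energy Balance Criterion (for $\mathscr N_{\mathbf u}^\tau,\mathscr N_\theta^\tau$).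 For every pair $\mathbf n'=(\mathbf m',\mathbf p',c')\in\mathscr N_{\mathbf u}^\tau$, $\mathbf n''=(\mathbf m'',\mathbf p'',c'')\in\mathscr N_\theta^\tau$ with $(m_1',m_2')=(m_1'',m_2'')\ne\mathbf 0$, $\mathbf p'=\mathbf p''$, and either $\mathsf k_1m_1'\ne\mathsf k_2m_2'$ or $c'=2$, set $\mathbf n^\pm=(0,0,|m_3'\pm m_3''|,0,0,1)$. If $m_3'=m_3''$, then $\mathbf n^+\in\mathscr N_\theta^\tau$. If $m_3'\ne m_3''$, then either both $\mathbf n^+,\mathbf n^-\in\mathscr N_\theta^\tau$ or both $\mathbf n^+,\mathbf n^-\notin\mathscr N_\theta^\tau$. *)

theory Defs
  imports "HOL-Analysis.Analysis"
begin

definition wavenumbers :: "real \<Rightarrow> real \<Rightarrow> real^3" where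
  "wavenumbers k1 k2 = vector [k1, k2, inverse (k1 * k2)]"

definition Omega :: "real \<Rightarrow> real \<Rightarrow> (real^3) set" where
  "Omega k1 k2 =
     cbox 0 (vector [2 * pi / wavenumbers k1 k2 $ 1, 2 * pi / wavenumbers k1 k2 $ 2,
                     pi / wavenumbers k1 k2 $ 3])"

text \<open>The bracket \<open>\<langle>g\<rangle>\<close> is the plain integral over the domain, not divided by its volume.\<close>

definition bracket :: "real \<Rightarrow> real \<Rightarrow> (real^3 \<Rightarrow> real) \<Rightarrow> real" where
  "bracket k1 k2 g = integral (Omega k1 k2) g"

definition pd :: "3 \<Rightarrow> (real^3 \<Rightarrow> real) \<Rightarrow> real^3 \<Rightarrow> real" where
  "pd i g x = deriv (\<lambda>h. g (x + h *\<^sub>R axis i 1)) 0"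

definition laplace :: "(real^3 \<Rightarrow> real) \<Rightarrow> real^3 \<Rightarrow> real" where
  "laplace g x = (\<Sum>i\<in>UNIV. pd i (pd i g) x)"

definition vlaplace :: "(real^3 \<Rightarrow> real^3) \<Rightarrow> real^3 \<Rightarrow> real^3" where
  "vlaplace w x = (\<chi> j. laplace (\<lambda>y. w y $ j) x)"

definition advect :: "(real^3 \<Rightarrow> real^3) \<Rightarrow> (real^3 \<Rightarrow> real) \<Rightarrow> real^3 \<Rightarrow> real" where
  "advect w g x = (\<Sum>i\<in>UNIV. w x $ i * pd i g x)"

definition vadvect :: "(real^3 \<Rightarrow> real^3) \<Rightarrow> (real^3 \<Rightarrow> real^3) \<Rightarrow> real^3 \<Rightarrow> real^3" where
  "vadvect w z x = (\<chi> j. advect w (\<lambda>y. z y $ j) x)"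

datatype mode = Mode (wave: "nat^3") (phase: "nat \<times> nat") (kind: nat)

text \<open>The phase vector extended by \<open>p\<^sub>3 = 0\<close>.\<close>

definition phase3 :: "mode \<Rightarrow> nat^3" where
  "phase3 n = vector [fst (phase n), snd (phase n), 0]"

text \<open>Phases are natural numbers read modulo 2: only their parity is used here.\<close>

definition trig :: "nat \<Rightarrow> nat \<Rightarrow> real \<Rightarrow> real" where
  "trig m p x = (if even p then cos (real m * x) else sin (real m * x))"

definition iota :: "nat \<Rightarrow> nat" where
  "iota m = (if m = 0 then 0 else 1)"

definition kron :: "3 \<Rightarrow> 3 \<Rightarrow> nat" where
  "kron i j = (if i = j then 1 else 0)"

definition eta :: "nat^3 \<Rightarrow> real" where
  "eta m = (\<Prod>k\<in>UNIV. sqrt 2 ^ iota (m $ k))"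

definition Vnorm :: real where
  "Vnorm = sqrt (4 * pi ^ 3)"

definition temp_phases :: "nat \<Rightarrow> nat set" where
  "temp_phases m = (if m = 0 then {0} else {0, 1})"

definition temp_modes :: "mode set" where
  "temp_modes = {n. wave n $ 3 > 0 \<and>
     phase n \<in> temp_phases (wave n $ 1) \<times> temp_phases (wave n $ 2) \<and> kind n = 1}"

definition temp_modes_star :: "mode set" where
  "temp_modes_star =
     {n \<in> temp_modes. wave n $ 1 = 0 \<and> wave n $ 2 = 0 \<and> wave n $ 3 > 0}"

definition temp_fun :: "real \<Rightarrow> real \<Rightarrow> mode \<Rightarrow> real^3 \<Rightarrow> real" where
  "temp_fun k1 k2 n x = eta (wave n) / Vnorm *
     trig (wave n $ 1) (fst (phase n)) (wavenumbers k1 k2 $ 1 * x $ 1) *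
     trig (wave n $ 2) (snd (phase n)) (wavenumbers k1 k2 $ 2 * x $ 2) *
     trig (wave n $ 3) 1 (wavenumbers k1 k2 $ 3 * x $ 3)"

definition diag :: "real^3 \<Rightarrow> real^3^3" where
  "diag a = (\<chi> i j. if i = j then a $ i else 0)"

definition gamma_vec :: "real^3" where
  "gamma_vec = vector [1, 1, -1]"

definition Kwave :: "real \<Rightarrow> real \<Rightarrow> nat^3 \<Rightarrow> real^3" where
  "Kwave k1 k2 m = diag (wavenumbers k1 k2) *v (\<chi> i. real (m $ i))"

definition Gmat :: "real \<Rightarrow> real \<Rightarrow> mode \<Rightarrow> real^3^3" where
  "Gmat k1 k2 n =
     (if kind n = 1 then diag (cross3 gamma_vec (Kwave k1 k2 (wave n)))
      else diag (cross3 (Kwave k1 k2 (wave n)) (cross3 gamma_vec (Kwave k1 k2 (wave n)))))"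

definition nu_vec :: "mode \<Rightarrow> real^3" where
  "nu_vec n =
     (\<chi> i. \<Prod>j\<in>UNIV. real (iota (wave n $ j)) ^ ((phase3 n $ j + kron i j) mod 2))"

definition sigma :: "mode \<Rightarrow> real^3^3" where
  "sigma n = diag (vector [(-1) ^ fst (phase n), (-1) ^ snd (phase n), 1])"

definition vel_fun :: "real \<Rightarrow> real \<Rightarrow> mode \<Rightarrow> real^3 \<Rightarrow> real^3" where
  "vel_fun k1 k2 n x =
     (\<chi> i. eta (wave n) / (norm (Gmat k1 k2 n *v nu_vec n) * Vnorm) *
        Gmat k1 k2 n $ i $ i * sigma n $ i $ i *
        (\<Prod>j\<in>UNIV. trig (wave n $ j) (phase3 n $ j + kron i j) (wavenumbers k1 k2 $ j * x $ j)))"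

definition vel_phases :: "nat^3 \<Rightarrow> (nat \<times> nat) set" where
  "vel_phases m =
     (if m $ 1 > 0 \<and> m $ 2 = 0 \<and> m $ 3 = 0 then {0, 1} \<times> {1}
      else if m $ 2 > 0 \<and> m $ 1 = 0 \<and> m $ 3 = 0 then {1} \<times> {0, 1}
      else if m $ 3 > 0 \<and> m $ 1 = 0 \<and> m $ 2 = 0 then {(0, 1), (1, 0)}
      else {0, 1} \<times> {0, 1})"

definition vel_kinds :: "nat^3 \<Rightarrow> nat set" where
  "vel_kinds m = (if \<forall>k. m $ k > 0 then {1, 2} else {1})"

definition vel_modes :: "mode set" where
  "vel_modes =
     {n. wave n \<noteq> 0 \<and> phase n \<in> vel_phases (wave n) \<and> kind n \<in> vel_kinds (wave n)}"

definition vel_field :: "real \<Rightarrow> real \<Rightarrow> mode set \<Rightarrow> (mode \<Rightarrow> real) \<Rightarrow> real^3 \<Rightarrow> real^3" where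
  "vel_field k1 k2 Nu a x = (\<Sum>n\<in>Nu. a n *\<^sub>R vel_fun k1 k2 n x)"

definition temp_field :: "real \<Rightarrow> real \<Rightarrow> mode set \<Rightarrow> (mode \<Rightarrow> real) \<Rightarrow> real^3 \<Rightarrow> real" where
  "temp_field k1 k2 Nt b x = (\<Sum>n\<in>Nt. b n * temp_fun k1 k2 n x)"

definition vel_proj ::
  "real \<Rightarrow> real \<Rightarrow> mode set \<Rightarrow> (real^3 \<Rightarrow> real^3) \<Rightarrow> real^3 \<Rightarrow> real^3" where
  "vel_proj k1 k2 Nu w x =
     (\<Sum>n\<in>Nu. bracket k1 k2 (\<lambda>y. w y \<bullet> vel_fun k1 k2 n y) *\<^sub>R vel_fun k1 k2 n x)"

definition temp_proj ::
  "real \<Rightarrow> real \<Rightarrow> mode set \<Rightarrow> (real^3 \<Rightarrow> real) \<Rightarrow> real^3 \<Rightarrow> real" where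
  "temp_proj k1 k2 Nt g x =
     (\<Sum>n\<in>Nt. bracket k1 k2 (\<lambda>y. g y * temp_fun k1 k2 n y) * temp_fun k1 k2 n x)"

definition vel_rhs ::
  "real \<Rightarrow> real \<Rightarrow> real \<Rightarrow> real \<Rightarrow> real \<Rightarrow> mode set \<Rightarrow>
   (real^3 \<Rightarrow> real^3) \<Rightarrow> (real^3 \<Rightarrow> real) \<Rightarrow> real^3 \<Rightarrow> real^3" where
  "vel_rhs k1 k2 P R S Nu w g x =
     P *\<^sub>R vlaplace w x
     + (P * R) *\<^sub>R vel_proj k1 k2 Nu (\<lambda>y. g y *\<^sub>R axis 3 1) x
     - (P * S) *\<^sub>R vel_proj k1 k2 Nu (\<lambda>y. cross3 (axis 3 1) (w y)) x
     - vel_proj k1 k2 Nu (vadvect w w) x"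

definition temp_rhs ::
  "real \<Rightarrow> real \<Rightarrow> mode set \<Rightarrow> (real^3 \<Rightarrow> real^3) \<Rightarrow> (real^3 \<Rightarrow> real) \<Rightarrow> real^3 \<Rightarrow> real" where
  "temp_rhs k1 k2 Nt w g x =
     laplace g x + temp_proj k1 k2 Nt (\<lambda>y. w y $ 3) x - temp_proj k1 k2 Nt (advect w g) x"

text \<open>
  \<open>u t n\<close> and \<open>th t n\<close> are the coefficients of the mode \<open>n\<close> at time \<open>t\<close>; only their values for
  \<open>t \<ge> 0\<close> and for \<open>n\<close> in \<open>Nu\<close> resp. \<open>Nt\<close> matter. The derivative at \<open>t = 0\<close> is one-sided.
\<close>

definition model_solution ::
  "real \<Rightarrow> real \<Rightarrow> real \<Rightarrow> real \<Rightarrow> real \<Rightarrow> mode set \<Rightarrow> mode set \<Rightarrow>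
   (mode \<Rightarrow> real) \<Rightarrow> (mode \<Rightarrow> real) \<Rightarrow>
   (real \<Rightarrow> mode \<Rightarrow> real) \<Rightarrow> (real \<Rightarrow> mode \<Rightarrow> real) \<Rightarrow> bool" where
  "model_solution k1 k2 P R S Nu Nt u0 th0 u th \<longleftrightarrow>
     (\<forall>n\<in>Nu. u 0 n = u0 n) \<and> (\<forall>n\<in>Nt. th 0 n = th0 n) \<and>
     (\<forall>n\<in>Nu. (\<lambda>t. u t n) differentiable_on {0..}) \<and>
     (\<forall>n\<in>Nt. (\<lambda>t. th t n) differentiable_on {0..}) \<and>
     (\<forall>t\<ge>0. \<forall>x\<in>Omega k1 k2.
        ((\<lambda>s. vel_field k1 k2 Nu (u s) x) has_vector_derivative
           vel_rhs k1 k2 P R S Nu (vel_field k1 k2 Nu (u t)) (temp_field k1 k2 Nt (th t)) x)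
          (at t within {0..}) \<and>
        ((\<lambda>s. temp_field k1 k2 Nt (th s) x) has_real_derivative
           temp_rhs k1 k2 Nt (vel_field k1 k2 Nu (u t)) (temp_field k1 k2 Nt (th t)) x)
          (at t within {0..}))"

definition heat_flux ::
  "real \<Rightarrow> real \<Rightarrow> mode set \<Rightarrow> mode set \<Rightarrow> (mode \<Rightarrow> real) \<Rightarrow> (mode \<Rightarrow> real) \<Rightarrow> real" where
  "heat_flux k1 k2 Nu Nt a b =
     bracket k1 k2 (\<lambda>x. vel_field k1 k2 Nu a x $ 3 * temp_field k1 k2 Nt b x)"

text \<open>
  The limit of the time averages need not exist for every solution. The upper limit in the extended
  reals is always defined, and it is the limit whenever the latter exists (next lemma).
\<close>

definition nusselt ::
  "real \<Rightarrow> real \<Rightarrow> mode set \<Rightarrow> mode set \<Rightarrow>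
   (real \<Rightarrow> mode \<Rightarrow> real) \<Rightarrow> (real \<Rightarrow> mode \<Rightarrow> real) \<Rightarrow> ereal" where
  "nusselt k1 k2 Nu Nt u th =
     1 + ereal (1 / (4 * pi ^ 4)) *
       Limsup at_top
         (\<lambda>t. ereal (1 / t * integral {0..t} (\<lambda>s. heat_flux k1 k2 Nu Nt (u s) (th s))))"

lemma nusselt_eq_lim:
  assumes "((\<lambda>t. 1 / t * integral {0..t} (\<lambda>s. heat_flux k1 k2 Nu Nt (u s) (th s)))
              \<longlongrightarrow> L) at_top"
  shows "nusselt k1 k2 Nu Nt u th = ereal (1 + 1 / (4 * pi ^ 4) * L)"
proof -
  have "Limsup at_top
      (\<lambda>t. ereal (1 / t * integral {0..t} (\<lambda>s. heat_flux k1 k2 Nu Nt (u s) (th s)))) = ereal L"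
    using assms by (intro lim_imp_Limsup tendsto_ereal) auto
  then show ?thesis
    unfolding nusselt_def by (simp add: one_ereal_def)
qed

definition vertical_mode :: "nat \<Rightarrow> mode" where
  "vertical_mode m = Mode (vector [0, 0, m]) (0, 0) 1"

definition energy_balance :: "real \<Rightarrow> real \<Rightarrow> mode set \<Rightarrow> mode set \<Rightarrow> bool" where
  "energy_balance k1 k2 Nu Nt \<longleftrightarrow>
     (\<forall>n'\<in>Nu. \<forall>n''\<in>Nt.
        (wave n' $ 1, wave n' $ 2) = (wave n'' $ 1, wave n'' $ 2) \<and>
        (wave n' $ 1, wave n' $ 2) \<noteq> (0, 0) \<and>
        phase n' = phase n'' \<and>
        (k1 * real (wave n' $ 1) \<noteq> k2 * real (wave n' $ 2) \<or> kind n' = 2) \<longrightarrow>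
        (let np = vertical_mode (wave n' $ 3 + wave n'' $ 3);
             nm = vertical_mode (nat \<bar>int (wave n' $ 3) - int (wave n'' $ 3)\<bar>)
         in (wave n' $ 3 = wave n'' $ 3 \<longrightarrow> np \<in> Nt) \<and>
            (wave n' $ 3 \<noteq> wave n'' $ 3 \<longrightarrow>
               (np \<in> Nt \<and> nm \<in> Nt) \<or> (np \<notin> Nt \<and> nm \<notin> Nt))))"

text \<open>
  The maximum over the empty set is taken to be 1, the smallest vertical wavenumber of a temperature
  mode: without horizontally constant modes the criterion forces the heat flux to vanish, so the
  Nusselt number is 1.
\<close>

definition max_vertical :: "mode set \<Rightarrow> nat" where
  "max_vertical A = (if A = {} then 1 else Max ((\<lambda>n. wave n $ 3) ` A))"

end

theory Submission
  imports Defs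
begin

text \<open>
  Horizontally constant modes carry no velocity flux, so the equation of such a coefficient
  expresses \<open>\<langle>u\<^sub>3 \<theta> cos (m k\<^sub>3 x\<^sub>3)\<rangle>\<close> through that coefficient and its time derivative. The
  Energy Balance Criterion makes \<open>1 + 2 \<Sum> cos (m k\<^sub>3 x\<^sub>3)\<close>, summed over the vertical wavenumbers
  \<open>m\<close> of these modes, orthogonal to every product of a vertical velocity mode and a temperature
  mode. Hence the heat flux itself is a combination \<open>F = - \<Sum> w\<^sub>s (\<theta>\<^sub>s' + \<lambda>\<^sub>s \<theta>\<^sub>s)\<close>. Together with
  the temperature balance \<open>F = \<Sum> \<theta>\<^sub>n \<theta>\<^sub>n' + \<Sum> \<lambda>\<^sub>n \<theta>\<^sub>n\<^sup>2\<close>, completing squares gives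
  \<open>F \<le> \<Phi>' + \<Sum> \<lambda>\<^sub>s w\<^sub>s\<^sup>2\<close> with \<open>\<Phi> = - 2 \<Sum> w\<^sub>s \<theta>\<^sub>s - (\<Sum> \<theta>\<^sub>n\<^sup>2) / 2\<close> bounded above, and each
  \<open>\<lambda>\<^sub>s w\<^sub>s\<^sup>2\<close> equals \<open>8 \<pi>\<^sup>3\<close>.
\<close>

subsection \<open>Separable and trigonometric integrals\<close>

lemma prod_Basis_vec:
  fixes g :: "real^'n \<Rightarrow> real"
  shows "(\<Prod>b\<in>Basis. g b) = (\<Prod>i\<in>UNIV. g (axis i 1))"
proof -
  have Basis: "(Basis :: (real^'n) set) = range (\<lambda>i. axis i 1)"
    by (auto simp: Basis_vec_def)
  show ?thesis
    unfolding Basis by (subst prod.reindex) (auto simp: inj_on_def axis_eq_axis)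
qed

text \<open>Fubini for separable integrands: Lebesgue measure is the image of the product measure
  over \<open>Basis\<close>, and the indicator of the box factors over the coordinates as
  well.\<close>

lemma integral_cbox_prod:
  fixes \<phi> :: "'n::finite \<Rightarrow> real \<Rightarrow> real" and a b :: "real^'n"
  assumes cont: "\<And>i. continuous_on UNIV (\<phi> i)"
  shows "integral (cbox a b) (\<lambda>x. \<Prod>i\<in>UNIV. \<phi> i (x $ i))
    = (\<Prod>i\<in>UNIV. integral {a $ i..b $ i} (\<phi> i))"
proof -
  interpret product_sigma_finite "\<lambda>b::real^'n. (lborel :: real measure)"
    by standard
  \<comment> \<open>The product measure is indexed by \<open>Basis\<close>, the factors by
    \<open>'n\<close>; \<open>ix\<close> recovers the coordinate from a basis vector.\<close>
  define ix where "ix e = (THE i. e = axis i (1::real))" for e :: "real^'n"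
  have ix: "ix (axis i 1) = i" for i
    unfolding ix_def by (rule the_equality) (auto simp: axis_eq_axis)
  define g where "g i = (\<lambda>y. indicator {a $ i..b $ i} y * \<phi> i y)" for i
  have g_int: "integrable lborel (g i)" for i
    using borel_integrable_compact[of "{a $ i..b $ i}" "\<phi> i"] continuous_on_subset[OF cont]
    by (force simp: g_def set_integrable_def)
  have g_meas: "g i \<in> borel_measurable borel" for i
    using borel_measurable_integrable[OF g_int] by simp
  have g_val: "(LINT y|lborel. g i y) = integral {a $ i..b $ i} (\<phi> i)" for i
    using set_borel_integral_eq_integral(2)[of "{a $ i..b $ i}" "\<phi> i"] g_int[of i]
    by (simp add: g_def set_integrable_def set_lebesgue_integral_def)
  have ind: "indicator (cbox a b) x *\<^sub>R (\<Prod>i\<in>UNIV. \<phi> i (x $ i)) = (\<Prod>i\<in>UNIV. g i (x $ i))" for x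
  proof (cases "x \<in> cbox a b")
    case True
    then show ?thesis by (auto simp: g_def mem_box_cart intro!: prod.cong)
  next
    case False
    then obtain i where "x $ i \<notin> {a $ i..b $ i}" by (auto simp: mem_box_cart)
    then have "g i (x $ i) = 0" by (simp add: g_def)
    then have "(\<Prod>i\<in>UNIV. g i (x $ i)) = 0" by auto
    then show ?thesis using False by simp
  qed
  have contp: "continuous_on (cbox a b) (\<lambda>x. \<Prod>i\<in>UNIV. \<phi> i (x $ i))"
    by (intro continuous_on_prod continuous_on_compose2[OF cont] continuous_intros) auto
  have si: "set_integrable lborel (cbox a b) (\<lambda>x. \<Prod>i\<in>UNIV. \<phi> i (x $ i))"
    unfolding set_integrable_def using borel_integrable_compact[OF compact_cbox contp] by simp
  have "integral (cbox a b) (\<lambda>x. \<Prod>i\<in>UNIV. \<phi> i (x $ i))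
      = (LINT x|lborel. (\<Prod>i\<in>UNIV. g i (x $ i)))"
    using set_borel_integral_eq_integral(2)[OF si]
    by (simp add: set_lebesgue_integral_def ind del: real_scaleR_def)
  also have "\<dots> = (LINT x|lborel. (\<Prod>e\<in>Basis. g (ix e) (x \<bullet> e)))"
    by (simp add: prod_Basis_vec ix inner_axis)
  also have "\<dots> = (LINT f|(\<Pi>\<^sub>M e\<in>Basis. lborel).
      (\<Prod>e\<in>Basis. g (ix e) ((\<Sum>b\<in>Basis. f b *\<^sub>R b) \<bullet> e)))"
    by (subst lborel_eq) (intro integral_distr, auto intro!: borel_measurable_prod measurable_compose[OF _ g_meas])
  also have "\<dots> = (LINT f|(\<Pi>\<^sub>M e\<in>Basis. lborel). (\<Prod>e\<in>(Basis::(real^'n) set). g (ix e) (f e)))"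
    by (intro Bochner_Integration.integral_cong refl prod.cong)
      (simp add: inner_sum_left inner_Basis if_distrib cong: if_cong)
  also have "\<dots> = (\<Prod>e\<in>Basis. LINT y|lborel. g (ix e) y)"
    by (rule product_integral_prod) (auto intro: g_int)
  finally show ?thesis by (simp add: prod_Basis_vec ix g_val)
qed

text \<open>For nonzero \<open>j\<close> the antiderivative is a sine that vanishes at both ends.
  The frequency is an integer of either sign because sums and differences of wavenumbers are
  inserted later.\<close>

lemma integral_cos_half_period:
  fixes c :: real and j :: int
  assumes "c > 0"
  shows "integral {0..pi / c} (\<lambda>x. cos (of_int j * c * x)) = (if j = 0 then pi / c else 0)"
proof (cases "j = 0")
  case True
  then show ?thesis using assms by simp
next
  case False
  have "((\<lambda>x. cos (of_int j * c * x)) has_integral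
      sin (of_int j * c * (pi / c)) / (of_int j * c) - sin (of_int j * c * 0) / (of_int j * c)) {0..pi / c}"
    using assms False
    by (intro fundamental_theorem_of_calculus)
      (auto intro!: derivative_eq_intros simp: has_real_derivative_iff_has_vector_derivative[symmetric])
  moreover have "sin (of_int j * c * (pi / c)) = 0"
    using assms by (auto simp: sin_zero_iff_int2)
  ultimately show ?thesis using False by (simp add: integral_unique)
qed

text \<open>A full period for \<open>c\<close> is a half period for \<open>c / 2\<close> with
  doubled index.\<close>

lemma integral_cos_period:
  fixes c :: real and j :: int
  assumes "c > 0"
  shows "integral {0..2 * pi / c} (\<lambda>x. cos (of_int j * c * x)) = (if j = 0 then 2 * pi / c else 0)"
proof -
  have eqs: "pi / (c / 2) = 2 * pi / c" "real_of_int (2 * j) * (c / 2) = real_of_int j * c"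
      "2 * j = 0 \<longleftrightarrow> j = 0"
    by simp_all
  show ?thesis
    using integral_cos_half_period[of "c / 2" "2 * j"] assms unfolding eqs by simp
qed

lemma integral_sin_period:
  fixes c :: real and j :: int
  assumes "c > 0"
  shows "integral {0..2 * pi / c} (\<lambda>x. sin (of_int j * c * x)) = 0"
proof (cases "j = 0")
  case False
  have "((\<lambda>x. sin (of_int j * c * x)) has_integral
      - cos (of_int j * c * (2 * pi / c)) / (of_int j * c) - - cos (of_int j * c * 0) / (of_int j * c))
      {0..2 * pi / c}"
    using assms False
    by (intro fundamental_theorem_of_calculus)
      (auto intro!: derivative_eq_intros simp: has_real_derivative_iff_has_vector_derivative[symmetric])
  moreover have "cos (of_int j * c * (2 * pi / c)) = 1"
    using assms cos_int_2pin[of j] by (simp add: mult.commute mult.left_commute)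
  ultimately show ?thesis using False by (simp add: integral_unique)
qed simp

lemma continuous_trig [continuous_intros]:
  fixes g :: "'a::t2_space \<Rightarrow> real"
  shows "continuous_on S g \<Longrightarrow> continuous_on S (\<lambda>x. trig m p (g x))"
  by (cases "even p") (simp_all add: trig_def continuous_on_cos continuous_on_sin continuous_on_mult)

text \<open>Product-to-sum formulas leave only zero frequencies. For \<open>m = 0\<close> the factor
  \<open>1 - p\<close> separates the constant cosine from the sine, which is identically
  zero.\<close>

lemma integral_trig_mult_trig:
  fixes c :: real
  assumes "c > 0" and "p \<in> {0, 1}" and "q \<in> {0, 1}"
  shows "integral {0..2 * pi / c} (\<lambda>x. trig m p (c * x) * trig n q (c * x)) =
    (if m = n \<and> p = q then (if m = 0 then (1 - p) * (2 * pi / c) else pi / c) else 0)"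
proof -
  let ?C = "\<lambda>j::int. (\<lambda>x. cos (of_int j * c * x))"
  let ?S = "\<lambda>j::int. (\<lambda>x. sin (of_int j * c * x))"
  have iC: "(?C j) integrable_on {0..2 * pi / c}" and iS: "(?S j) integrable_on {0..2 * pi / c}" for j
    by (auto intro!: integrable_continuous_real continuous_intros)
  have half: "integral {0..2 * pi / c} (\<lambda>x. (f x + s * g x) / 2)
      = (integral {0..2 * pi / c} f + s * integral {0..2 * pi / c} g) / 2"
    if "f integrable_on {0..2 * pi / c}" "g integrable_on {0..2 * pi / c}" for f g and s :: real
    using that by (simp add: integral_add integrable_on_mult_right)
  note int = integral_cos_period[OF assms(1)] integral_sin_period[OF assms(1)] half iC iS
  consider "p = 0" "q = 0" | "p = 1" "q = 1" | "p = 0" "q = 1" | "p = 1" "q = 0"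
    using assms by auto
  then show ?thesis
  proof cases
    case 1
    have "trig m p (c * x) * trig n q (c * x)
        = (?C (int m - int n) x + 1 * ?C (int m + int n) x) / 2" for x
      using 1 by (simp add: trig_def cos_times_cos algebra_simps)
    then show ?thesis using 1 by (simp only: int) auto
  next
    case 2
    have "trig m p (c * x) * trig n q (c * x)
        = (?C (int m - int n) x + (- 1) * ?C (int m + int n) x) / 2" for x
      using 2 by (simp add: trig_def sin_times_sin algebra_simps)
    then show ?thesis using 2 by (simp only: int) auto
  next
    case 3
    have "trig m p (c * x) * trig n q (c * x)
        = (?S (int m + int n) x + (- 1) * ?S (int m - int n) x) / 2" for x
      using 3 by (simp add: trig_def sin_add sin_diff algebra_simps)
    then show ?thesis using 3 by (simp only: int) auto
  next
    case 4
    have "trig m p (c * x) * trig n q (c * x)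
        = (?S (int m + int n) x + 1 * ?S (int m - int n) x) / 2" for x
      using 4 by (simp add: trig_def sin_add sin_diff algebra_simps)
    then show ?thesis using 4 by (simp only: int) auto
  qed
qed

text \<open>The product is a sum of four cosines with coefficients 1/4 or -1/4, so only resonances
  among the three wavenumbers survive, even on half a period.\<close>

lemma integral_sin_sin_cos:
  fixes c :: real
  assumes "c > 0"
  shows "integral {0..pi / c} (\<lambda>x. trig m 1 (c * x) * trig n 1 (c * x) * trig k 0 (c * x)) =
    pi / (4 * c) * (of_bool (int m - int n + int k = 0) + of_bool (int m - int n - int k = 0)
      - of_bool (int m + int n + int k = 0) - of_bool (int m + int n - int k = 0))"
proof -
  let ?C = "\<lambda>j::int. (\<lambda>x. cos (of_int j * c * x))"
  have iC: "(?C j) integrable_on {0..pi / c}" for j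
    by (auto intro!: integrable_continuous_real continuous_intros)
  have prod: "sin a * sin b * cos d
      = (cos (a - b + d) + cos (a - b - d) - cos (a + b + d) - cos (a + b - d)) / 4" for a b d :: real
    by (simp add: cos_add cos_diff sin_add sin_diff algebra_simps)
  have "trig m 1 (c * x) * trig n 1 (c * x) * trig k 0 (c * x)
      = (?C (int m - int n + int k) x + ?C (int m - int n - int k) x
        - ?C (int m + int n + int k) x - ?C (int m + int n - int k) x) / 4" for x
    using prod[of "real m * c * x" "real n * c * x" "real k * c * x"]
    by (simp add: trig_def algebra_simps)
  then have "integral {0..pi / c} (\<lambda>x. trig m 1 (c * x) * trig n 1 (c * x) * trig k 0 (c * x))
      = (integral {0..pi / c} (?C (int m - int n + int k)) + integral {0..pi / c} (?C (int m - int n - int k))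
        - integral {0..pi / c} (?C (int m + int n + int k)) - integral {0..pi / c} (?C (int m + int n - int k))) / 4"
    by (simp only: integral_divide integral_add integral_diff integrable_add integrable_diff iC)
  then show ?thesis
    unfolding integral_cos_half_period[OF assms]
    by (simp only: of_bool_def) (simp add: field_simps)
qed

subsection \<open>Partial derivatives of separable functions\<close>

text \<open>A relation that carries the existence of the derivative and so composes by rules,
  whereas \<open>deriv\<close>, on which \<open>pd\<close> rests, is informative only under
  differentiability.\<close>

definition has_pd :: "3 \<Rightarrow> (real^3 \<Rightarrow> real) \<Rightarrow> (real^3 \<Rightarrow> real) \<Rightarrow> bool" where
  "has_pd i g g' \<longleftrightarrow> (\<forall>x. ((\<lambda>h. g (x + h *\<^sub>R axis i 1)) has_real_derivative g' x) (at 0))"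

lemma has_pd_imp_pd: "has_pd i g g' \<Longrightarrow> pd i g = g'"
  by (auto simp: has_pd_def pd_def fun_eq_iff intro!: DERIV_imp_deriv)

lemma has_pd_unique: "has_pd i g g' \<Longrightarrow> has_pd i g g'' \<Longrightarrow> g' = g''"
  using has_pd_imp_pd by metis

lemma has_pd_cmult: "has_pd i g g' \<Longrightarrow> has_pd i (\<lambda>x. c * g x) (\<lambda>x. c * g' x)"
  unfolding has_pd_def by (auto intro!: derivative_eq_intros)

lemma has_pd_mult:
  "has_pd i f f' \<Longrightarrow> has_pd i g g' \<Longrightarrow> has_pd i (\<lambda>x. f x * g x) (\<lambda>x. f' x * g x + f x * g' x)"
  unfolding has_pd_def by (force intro!: derivative_eq_intros)

lemma has_pd_sum:
  assumes "\<And>n. n \<in> A \<Longrightarrow> has_pd i (f n) (f' n)"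
  shows "has_pd i (\<lambda>x. \<Sum>n\<in>A. f n x) (\<lambda>x. \<Sum>n\<in>A. f' n x)"
  using assms unfolding has_pd_def by (auto intro!: DERIV_sum)

lemma has_pd_prod:
  fixes \<phi> :: "3 \<Rightarrow> real \<Rightarrow> real"
  assumes "\<And>y. (\<phi> i has_real_derivative \<phi>' y) (at y)"
  shows "has_pd i (\<lambda>x. \<Prod>j\<in>UNIV. \<phi> j (x $ j)) (\<lambda>x. \<phi>' (x $ i) * (\<Prod>j\<in>UNIV - {i}. \<phi> j (x $ j)))"
  unfolding has_pd_def
proof
  fix x :: "real^3"
  have "(\<Prod>j\<in>UNIV. \<phi> j ((x + h *\<^sub>R axis i 1) $ j))
      = \<phi> i (x $ i + h) * (\<Prod>j\<in>UNIV - {i}. \<phi> j (x $ j))" for h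
    by (subst prod.remove[of _ i]) (auto simp: axis_def intro!: prod.cong)
  moreover have "((\<lambda>h. \<phi> i (x $ i + h)) has_real_derivative \<phi>' (x $ i)) (at 0)"
    using assms[of "x $ i"] DERIV_shift[of "\<phi> i" "\<phi>' (x $ i)" 0 "x $ i"]
    by (simp add: add.commute)
  ultimately show "((\<lambda>h. \<Prod>j\<in>UNIV. \<phi> j ((x + h *\<^sub>R axis i 1) $ j)) has_real_derivative
      \<phi>' (x $ i) * (\<Prod>j\<in>UNIV - {i}. \<phi> j (x $ j))) (at 0)"
    by (auto intro!: derivative_eq_intros)
qed

text \<open>The unnormalized shape shared by all modes and their derivatives. The phases form a
  function so that differentiation can update a single one.\<close>

definition profile :: "real^3 \<Rightarrow> nat^3 \<Rightarrow> (3 \<Rightarrow> nat) \<Rightarrow> real^3 \<Rightarrow> real" where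
  "profile K m q x = (\<Prod>j\<in>UNIV. trig (m $ j) (q j) (K $ j * x $ j))"

lemma continuous_on_profile [continuous_intros]: "continuous_on S (profile K m q)"
  unfolding profile_def by (intro continuous_intros)

text \<open>Differentiation raises the phase by one; the sign is negative exactly for the cosine,
  that is, for even \<open>p\<close>.\<close>

lemma DERIV_trig:
  "((\<lambda>y. trig m p (c * y)) has_real_derivative ((-1) ^ Suc p * (c * m)) * trig m (Suc p) (c * y)) (at y)"
  unfolding trig_def by (cases "even p") (auto intro!: derivative_eq_intros)

lemma has_pd_profile:
  "has_pd i (profile K m q)
    (\<lambda>x. ((-1) ^ Suc (q i) * (K $ i * m $ i)) * profile K m (q(i := Suc (q i))) x)"
proof -
  have "has_pd i (\<lambda>x. \<Prod>j\<in>UNIV. trig (m $ j) (q j) (K $ j * x $ j))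
    (\<lambda>x. ((-1) ^ Suc (q i) * (K $ i * m $ i)) * trig (m $ i) (Suc (q i)) (K $ i * x $ i) *
      (\<Prod>j\<in>UNIV - {i}. trig (m $ j) (q j) (K $ j * x $ j)))"
    by (rule has_pd_prod[where \<phi> = "\<lambda>j y. trig (m $ j) (q j) (K $ j * y)"]) (rule DERIV_trig)
  moreover have "profile K m (q(i := Suc (q i))) x = trig (m $ i) (Suc (q i)) (K $ i * x $ i) *
      (\<Prod>j\<in>UNIV - {i}. trig (m $ j) (q j) (K $ j * x $ j))" for x
    unfolding profile_def by (subst prod.remove[of _ i]) (auto intro!: prod.cong)
  ultimately show ?thesis
    by (simp add: profile_def[abs_def] mult.assoc)
qed

lemma profile_add_two: "profile K m (q(i := Suc (Suc (q i)))) = profile K m q"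
  unfolding profile_def trig_def by (intro ext prod.cong) auto

lemma trig_period: "trig m p (2 * pi) = trig m p 0"
  using cos_int_2pin[of "int m"] sin_int_2pin[of "int m"]
  by (simp add: trig_def mult.commute mult.left_commute)

section \<open>Integration over the periodic box\<close>

locale box =
  fixes k1 k2 :: real
  assumes k1: "k1 > 0" and k2: "k2 > 0"
begin

abbreviation "K \<equiv> wavenumbers k1 k2"

lemma K_pos: "K $ j > 0"
  using exhaust_3[of j] k1 k2 by (auto simp: wavenumbers_def)

definition side :: "3 \<Rightarrow> real" where
  "side j = (if j = 3 then pi else 2 * pi) / K $ j"

lemma Omega_eq: "Omega k1 k2 = cbox 0 (\<chi> j. side j)"
  unfolding Omega_def side_def
  by (rule arg_cong[where f = "cbox 0"]) (simp add: vec_eq_iff forall_3)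

lemma bracket_prod:
  assumes "\<And>i. continuous_on UNIV (\<phi> i)"
  shows "bracket k1 k2 (\<lambda>x. \<Prod>i\<in>UNIV. \<phi> i (x $ i)) = (\<Prod>i\<in>UNIV. integral {0..side i} (\<phi> i))"
  unfolding bracket_def Omega_eq integral_cbox_prod[OF assms] by simp

lemma bracket_integrable: "continuous_on UNIV g \<Longrightarrow> g integrable_on Omega k1 k2"
  for g :: "real^3 \<Rightarrow> real"
  unfolding Omega_eq by (rule integrable_continuous) (rule continuous_on_subset, auto)

lemma bracket_sum:
  assumes "finite A" "\<And>n. n \<in> A \<Longrightarrow> continuous_on UNIV (g n)"
  shows "bracket k1 k2 (\<lambda>x. \<Sum>n\<in>A. g n x) = (\<Sum>n\<in>A. bracket k1 k2 (g n))"
  unfolding bracket_def using assms by (intro integral_sum bracket_integrable)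

lemma bracket_cmult: "bracket k1 k2 (\<lambda>x. c * g x) = c * bracket k1 k2 g"
  unfolding bracket_def by simp

lemma bracket_lincomb:
  assumes "finite A" "\<And>n. n \<in> A \<Longrightarrow> continuous_on UNIV (g n)"
  shows "bracket k1 k2 (\<lambda>x. \<Sum>n\<in>A. c n * g n x) = (\<Sum>n\<in>A. c n * bracket k1 k2 (g n))"
  using assms by (subst bracket_sum) (auto simp: bracket_cmult intro!: continuous_intros)

text \<open>Periodicity in the horizontal directions and the vanishing of the sine at both plates
  remove the boundary terms.\<close>

lemma bracket_pd_eq_0:
  assumes G': "has_pd i (\<lambda>x. profile K m q x * profile K m' q' x * profile K m'' q'' x) G'"
    and sin3: "odd (q' 3)"
  shows "bracket k1 k2 G' = 0"
proof -
  define t where "t m q j y = trig (m $ j) (q j) (K $ j * y)" for m :: "nat^3" and q :: "3 \<Rightarrow> nat" and j y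
  define t' where "t' m q j y = ((-1) ^ Suc (q j) * (K $ j * (m $ j))) * trig (m $ j) (Suc (q j)) (K $ j * y)"
    for m :: "nat^3" and q :: "3 \<Rightarrow> nat" and j y
  define \<phi> where "\<phi> j y = t m q j y * t m' q' j y * t m'' q'' j y" for j y
  define \<phi>' where "\<phi>' y = (t' m q i y * t m' q' i y + t' m' q' i y * t m q i y) * t m'' q'' i y
      + t' m'' q'' i y * (t m q i y * t m' q' i y)" for y
  have t: "((\<lambda>y. t m q j y) has_real_derivative t' m q j y) (at y)" for m q j y
    unfolding t_def t'_def by (rule DERIV_trig)
  have deriv: "(\<phi> i has_real_derivative \<phi>' y) (at y)" for y
    unfolding \<phi>_def \<phi>'_def by (intro DERIV_mult t)
  have cont: "continuous_on S (\<phi> j)" for j S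
    unfolding \<phi>_def t_def by (intro continuous_intros)
  have cont': "continuous_on S \<phi>'" for S
    unfolding \<phi>'_def t_def t'_def by (intro continuous_intros)
  have "(\<lambda>x. profile K m q x * profile K m' q' x * profile K m'' q'' x)
      = (\<lambda>x. \<Prod>j\<in>UNIV. \<phi> j (x $ j))"
    by (simp add: profile_def \<phi>_def t_def prod.distrib)
  \<comment> \<open>Partial derivatives are unique, so the arbitrary \<open>G'\<close> is the one
    given by the product formula.\<close>
  then have "G' = (\<lambda>x. \<phi>' (x $ i) * (\<Prod>j\<in>UNIV - {i}. \<phi> j (x $ j)))"
    using has_pd_unique[OF G'] has_pd_prod[of \<phi>, OF deriv] by simp
  \<comment> \<open>Only factor \<open>i\<close> is replaced by its derivative, so the integrand
    remains separable and the fundamental theorem is applied in one coordinate only.\<close>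
  also have "\<dots> = (\<lambda>x. \<Prod>j\<in>UNIV. (\<phi>(i := \<phi>')) j (x $ j))"
    by (rule ext, subst prod.remove[of UNIV i]) (auto intro!: prod.cong)
  finally have "bracket k1 k2 G' = (\<Prod>j\<in>UNIV. integral {0..side j} ((\<phi>(i := \<phi>')) j))"
    using bracket_prod[of "\<phi>(i := \<phi>')"] cont cont' by simp
  moreover have "integral {0..side i} \<phi>' = 0"
  proof -
    have "(\<phi>' has_integral \<phi> i (side i) - \<phi> i 0) {0..side i}"
      using deriv K_pos[of i] by (intro fundamental_theorem_of_calculus)
        (auto simp: side_def has_real_derivative_iff_has_vector_derivative[symmetric]
          intro: has_field_derivative_at_within)
    moreover have "\<phi> i (side i) = \<phi> i 0"
    proof (cases "i = 3")
      case True
      then show ?thesis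
        using K_pos[of 3] sin3 by (simp add: \<phi>_def t_def side_def trig_def)
    next
      case False
      then have "K $ i * side i = 2 * pi"
        using K_pos[of i] by (simp add: side_def)
      then show ?thesis
        unfolding \<phi>_def t_def by (simp add: trig_period)
    qed
    ultimately show ?thesis
      by (simp add: integral_unique)
  qed
  ultimately show ?thesis
    by (auto intro!: prod_zero)
qed

end

subsection \<open>The modes\<close>

lemma prod_3: "(\<Prod>j\<in>UNIV. f j) = f 1 * f 2 * f 3" for f :: "3 \<Rightarrow> real"
  unfolding UNIV_3 by (simp add: ac_simps)

text \<open>Row \<open>i\<close> holds the phases of the \<open>i\<close>-th velocity component. Row
  3 also holds those of the temperature functions, whose vertical factor is a sine.\<close>

definition mode_phase :: "mode \<Rightarrow> 3 \<Rightarrow> 3 \<Rightarrow> nat" where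
  "mode_phase n i j = phase3 n $ j + kron i j"

context box
begin

definition vel_amp :: "mode \<Rightarrow> 3 \<Rightarrow> real" where
  "vel_amp n i = eta (wave n) / (norm (Gmat k1 k2 n *v nu_vec n) * Vnorm) *
     Gmat k1 k2 n $ i $ i * sigma n $ i $ i"

definition temp_amp :: "mode \<Rightarrow> real" where
  "temp_amp n = eta (wave n) / Vnorm"

lemma vel_fun_nth: "vel_fun k1 k2 n x $ i = vel_amp n i * profile K (wave n) (mode_phase n i) x"
  by (simp add: vel_fun_def vel_amp_def profile_def mode_phase_def)

lemma temp_fun_eq: "temp_fun k1 k2 n x = temp_amp n * profile K (wave n) (mode_phase n 3) x"
  by (simp add: temp_fun_def temp_amp_def profile_def mode_phase_def prod_3 phase3_def kron_def)

lemma temp_amp_pos: "temp_amp n > 0"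
  by (auto simp: temp_amp_def eta_def Vnorm_def intro!: divide_pos_pos prod_pos)

lemma continuous_on_vel_fun_nth [continuous_intros]: "continuous_on S (\<lambda>x. vel_fun k1 k2 n x $ i)"
  unfolding vel_fun_nth by (intro continuous_intros)

lemma continuous_on_temp_fun [continuous_intros]: "continuous_on S (temp_fun k1 k2 n)"
  unfolding temp_fun_eq[abs_def] by (intro continuous_intros)

definition temp_grad :: "mode \<Rightarrow> 3 \<Rightarrow> real^3 \<Rightarrow> real" where
  "temp_grad n i x = temp_amp n * (((-1) ^ Suc (mode_phase n 3 i) * (K $ i * (wave n $ i))) *
     profile K (wave n) ((mode_phase n 3)(i := Suc (mode_phase n 3 i))) x)"

lemma continuous_on_temp_grad [continuous_intros]: "continuous_on S (temp_grad n i)"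
  unfolding temp_grad_def by (intro continuous_intros)

lemma has_pd_temp_fun: "has_pd i (temp_fun k1 k2 n) (temp_grad n i)"
  unfolding temp_grad_def temp_fun_eq[abs_def] by (intro has_pd_cmult has_pd_profile)

text \<open>Two differentiations restore the phase modulo 2 and leave one net minus sign.\<close>

lemma has_pd_temp_grad: "has_pd i (temp_grad n i) (\<lambda>x. - (K $ i * (wave n $ i))\<^sup>2 * temp_fun k1 k2 n x)"
proof -
  let ?q = "mode_phase n 3"
  have "has_pd i (temp_grad n i) (\<lambda>x. temp_amp n * (((-1) ^ Suc (?q i) * (K $ i * (wave n $ i))) *
      (((-1) ^ Suc (Suc (?q i)) * (K $ i * (wave n $ i))) * profile K (wave n) (?q(i := Suc (Suc (?q i)))) x)))"
    unfolding temp_grad_def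
    using has_pd_profile[of i K "wave n" "?q(i := Suc (?q i))"]
    by (intro has_pd_cmult) simp
  moreover have "temp_amp n * (((-1) ^ Suc (?q i) * (K $ i * (wave n $ i))) *
      (((-1) ^ Suc (Suc (?q i)) * (K $ i * (wave n $ i))) * profile K (wave n) (?q(i := Suc (Suc (?q i)))) x))
      = - (K $ i * (wave n $ i))\<^sup>2 * temp_fun k1 k2 n x" for x
    by (cases "even (?q i)") (auto simp: profile_add_two temp_fun_eq power2_eq_square)
  ultimately show ?thesis by simp
qed

definition vel_div :: "mode \<Rightarrow> 3 \<Rightarrow> real^3 \<Rightarrow> real" where
  "vel_div n i x = vel_amp n i * (((-1) ^ Suc (mode_phase n i i) * (K $ i * (wave n $ i))) *
     profile K (wave n) ((mode_phase n i)(i := Suc (mode_phase n i i))) x)"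

lemma has_pd_vel_fun: "has_pd i (\<lambda>x. vel_fun k1 k2 n x $ i) (vel_div n i)"
  unfolding vel_div_def vel_fun_nth by (intro has_pd_cmult has_pd_profile)

lemma continuous_on_vel_div [continuous_intros]: "continuous_on S (vel_div n i)"
  unfolding vel_div_def by (intro continuous_intros)

text \<open>For either kind the diagonal is a cross product with the scaled wave vector as one
  factor. This is the divergence-free condition in Fourier form.\<close>

lemma Gmat_orthogonal: "(\<Sum>i\<in>UNIV. Gmat k1 k2 n $ i $ i * (K $ i * real (wave n $ i))) = 0"
proof -
  let ?\<kappa> = "Kwave k1 k2 (wave n)"
  have \<kappa>: "K $ i * real (wave n $ i) = ?\<kappa> $ i" for i
    using exhaust_3[of i] by (auto simp: Kwave_def diag_def matrix_vector_mult_def sum_3)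
  have "(\<Sum>i\<in>UNIV. w $ i * ?\<kappa> $ i) = w \<bullet> ?\<kappa>" for w
    by (simp add: inner_vec_def)
  then show ?thesis
    unfolding \<kappa> by (simp add: Gmat_def diag_def dot_cross_self)
qed

text \<open>Differentiating component \<open>i\<close> along \<open>i\<close> turns all three
  profiles into the same one, and \<open>sigma\<close> cancels the signs that arise;
  \<open>Gmat_orthogonal\<close> finishes.\<close>

lemma sum_vel_div: "(\<Sum>i\<in>UNIV. vel_div n i x) = 0"
proof -
  define A where "A = eta (wave n) / (norm (Gmat k1 k2 n *v nu_vec n) * Vnorm)"
  define E where "E = profile K (wave n) (\<lambda>j. phase3 n $ j) x"
  have "profile K (wave n) ((mode_phase n i)(i := Suc (mode_phase n i i))) x = E" for i
  proof -
    have "(mode_phase n i)(i := Suc (mode_phase n i i))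
        = (\<lambda>j. phase3 n $ j)(i := Suc (Suc (phase3 n $ i)))"
      by (auto simp: mode_phase_def kron_def fun_eq_iff)
    then show ?thesis
      unfolding E_def by (simp add: profile_add_two)
  qed
  moreover have "sigma n $ i $ i * (-1) ^ Suc (mode_phase n i i) = 1" for i
    using exhaust_3[of i]
    by (auto simp: sigma_def diag_def mode_phase_def kron_def phase3_def simp flip: power_mult_distrib)
  moreover have "vel_div n i x = (A * Gmat k1 k2 n $ i $ i * (K $ i * real (wave n $ i))) *
      (sigma n $ i $ i * (-1) ^ Suc (mode_phase n i i)) *
      profile K (wave n) ((mode_phase n i)(i := Suc (mode_phase n i i))) x" for i
    unfolding vel_div_def vel_amp_def A_def[symmetric] by (simp only: ac_simps)
  ultimately have "vel_div n i x = A * E * (Gmat k1 k2 n $ i $ i * (K $ i * real (wave n $ i)))" for i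
    by (simp only: mult_1_right) (simp only: ac_simps)
  then show ?thesis
    by (simp only: sum_distrib_left[symmetric] Gmat_orthogonal)
qed

section \<open>Skew-symmetry of the temperature transport\<close>

definition trilin :: "mode \<Rightarrow> mode \<Rightarrow> mode \<Rightarrow> real" where
  "trilin n' n m = bracket k1 k2 (\<lambda>x. advect (vel_fun k1 k2 n') (temp_fun k1 k2 n) x * temp_fun k1 k2 m x)"

lemma advect_temp_fun:
  "advect w (temp_fun k1 k2 n) x = (\<Sum>i\<in>UNIV. w x $ i * temp_grad n i x)"
  by (simp add: advect_def has_pd_imp_pd[OF has_pd_temp_fun])

lemma continuous_on_advect_temp_fun [continuous_intros]:
  "continuous_on S (\<lambda>x. advect (vel_fun k1 k2 n') (temp_fun k1 k2 n) x)"
  unfolding advect_temp_fun by (intro continuous_intros)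

text \<open>Since the velocity modes are divergence-free, the sum of both sides is the integral of
  the divergence of \<open>v f g\<close>, and each of its three terms integrates to zero.\<close>

lemma trilin_skew: "trilin n' n m = - trilin n' m n"
proof -
  define G where "G i x = (vel_div n' i x * temp_fun k1 k2 n x + vel_fun k1 k2 n' x $ i * temp_grad n i x)
      * temp_fun k1 k2 m x + vel_fun k1 k2 n' x $ i * temp_fun k1 k2 n x * temp_grad m i x" for i x
  have G: "bracket k1 k2 (G i) = 0" for i
  proof -
    define a where "a = vel_amp n' i * temp_amp n * temp_amp m"
    show ?thesis
    \<comment> \<open>\<open>bracket_pd_eq_0\<close> speaks of bare profiles, so the amplitude
      \<open>a\<close> is divided out. It can vanish, since a velocity mode may lack a
      component.\<close>
    proof (cases "a = 0")
      case True
      then have "vel_amp n' i = 0"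
        using temp_amp_pos[of n] temp_amp_pos[of m] by (simp add: a_def)
      then have "G i = (\<lambda>x. 0)"
        by (simp add: G_def vel_div_def vel_fun_nth fun_eq_iff)
      then show ?thesis by (simp add: bracket_def)
    next
      case False
      have "has_pd i (\<lambda>x. vel_fun k1 k2 n' x $ i * temp_fun k1 k2 n x * temp_fun k1 k2 m x) (G i)"
        unfolding G_def by (intro has_pd_mult has_pd_vel_fun has_pd_temp_fun)
      from has_pd_cmult[OF this, of "1 / a"]
      have "has_pd i (\<lambda>x. profile K (wave n') (mode_phase n' i) x * profile K (wave n) (mode_phase n 3) x
          * profile K (wave m) (mode_phase m 3) x) (\<lambda>x. 1 / a * G i x)"
        using False by (simp add: vel_fun_nth temp_fun_eq a_def mult.assoc mult.left_commute)
      from bracket_pd_eq_0[OF this]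
      have "bracket k1 k2 (\<lambda>x. 1 / a * G i x) = 0"
        by (simp add: mode_phase_def phase3_def kron_def)
      then show ?thesis
        using False unfolding bracket_cmult by simp
    qed
  qed
  have contG: "continuous_on UNIV (G i)" for i
    unfolding G_def by (intro continuous_intros)
  \<comment> \<open>The product rule terms in \<open>G\<close> contain the two transport terms plus
    a multiple of the divergence, which is subtracted here and is zero.\<close>
  have "advect (vel_fun k1 k2 n') (temp_fun k1 k2 n) x * temp_fun k1 k2 m x
      + advect (vel_fun k1 k2 n') (temp_fun k1 k2 m) x * temp_fun k1 k2 n x
      = (\<Sum>i\<in>UNIV. G i x) - (\<Sum>i\<in>UNIV. vel_div n' i x) * (temp_fun k1 k2 n x * temp_fun k1 k2 m x)" for x
    unfolding advect_temp_fun G_def by (simp add: sum_3 algebra_simps)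
  then have "(\<lambda>x. advect (vel_fun k1 k2 n') (temp_fun k1 k2 n) x * temp_fun k1 k2 m x
      + advect (vel_fun k1 k2 n') (temp_fun k1 k2 m) x * temp_fun k1 k2 n x) = (\<lambda>x. \<Sum>i\<in>UNIV. G i x)"
    by (simp add: sum_vel_div)
  then have "bracket k1 k2 (\<lambda>x. advect (vel_fun k1 k2 n') (temp_fun k1 k2 n) x * temp_fun k1 k2 m x
      + advect (vel_fun k1 k2 n') (temp_fun k1 k2 m) x * temp_fun k1 k2 n x) = 0"
    using bracket_sum[of UNIV G] contG G by simp
  moreover have "bracket k1 k2 (\<lambda>x. advect (vel_fun k1 k2 n') (temp_fun k1 k2 n) x * temp_fun k1 k2 m x
      + advect (vel_fun k1 k2 n') (temp_fun k1 k2 m) x * temp_fun k1 k2 n x) = trilin n' n m + trilin n' m n"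
    unfolding trilin_def bracket_def by (intro integral_add bracket_integrable continuous_intros)
  ultimately show ?thesis by simp
qed

section \<open>Overlap integrals of two modes against a vertical cosine\<close>

definition horiz :: "real \<Rightarrow> nat \<Rightarrow> nat \<Rightarrow> nat \<Rightarrow> nat \<Rightarrow> real" where
  "horiz c m p n q = integral {0..2 * pi / c} (\<lambda>x. trig m p (c * x) * trig n q (c * x))"

definition vert :: "nat \<Rightarrow> nat \<Rightarrow> nat \<Rightarrow> real" where
  "vert m n k = integral {0..pi / K $ 3}
     (\<lambda>x. trig m 1 (K $ 3 * x) * trig n 1 (K $ 3 * x) * trig k 0 (K $ 3 * x))"

definition profile_integral :: "mode \<Rightarrow> mode \<Rightarrow> nat \<Rightarrow> real" where
  "profile_integral n m k =
     horiz (K $ 1) (wave n $ 1) (fst (phase n)) (wave m $ 1) (fst (phase m)) *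
     horiz (K $ 2) (wave n $ 2) (snd (phase n)) (wave m $ 2) (snd (phase m)) *
     vert (wave n $ 3) (wave m $ 3) k"

text \<open>The integral separates, the cosine joining the two vertical sines. At
  \<open>k = 0\<close> it is the plain inner product of the profiles.\<close>

lemma bracket_profile_profile_cos:
  "bracket k1 k2 (\<lambda>x. profile K (wave n) (mode_phase n 3) x * profile K (wave m) (mode_phase m 3) x *
      cos (k * (K $ 3 * x $ 3))) = profile_integral n m k"
proof -
  define \<phi> where "\<phi> j y = trig (wave n $ j) (mode_phase n 3 j) (K $ j * y) *
      trig (wave m $ j) (mode_phase m 3 j) (K $ j * y) * (if j = 3 then trig k 0 (K $ j * y) else 1)"
    for j :: 3 and y
  have "continuous_on UNIV (\<phi> j)" for j
    unfolding \<phi>_def by (cases "j = 3") (auto intro!: continuous_intros)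
  moreover have cos: "cos (k * y) = trig k 0 y" for y :: real
    by (simp add: trig_def)
  have "(\<lambda>x. profile K (wave n) (mode_phase n 3) x * profile K (wave m) (mode_phase m 3) x *
      cos (k * (K $ 3 * x $ 3))) = (\<lambda>x. \<Prod>j\<in>UNIV. \<phi> j (x $ j))"
    unfolding profile_def \<phi>_def prod.distrib cos by simp
  ultimately have "bracket k1 k2 (\<lambda>x. profile K (wave n) (mode_phase n 3) x *
      profile K (wave m) (mode_phase m 3) x * cos (k * (K $ 3 * x $ 3)))
      = (\<Prod>j\<in>UNIV. integral {0..side j} (\<phi> j))"
    using bracket_prod by simp
  moreover have "integral {0..side 1} (\<phi> 1)
      = horiz (K $ 1) (wave n $ 1) (fst (phase n)) (wave m $ 1) (fst (phase m))"
    by (simp add: \<phi>_def[abs_def] side_def horiz_def mode_phase_def kron_def phase3_def)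
  moreover have "integral {0..side 2} (\<phi> 2)
      = horiz (K $ 2) (wave n $ 2) (snd (phase n)) (wave m $ 2) (snd (phase m))"
    by (simp add: \<phi>_def[abs_def] side_def horiz_def mode_phase_def kron_def phase3_def)
  moreover have "integral {0..side 3} (\<phi> 3) = vert (wave n $ 3) (wave m $ 3) k"
    by (simp add: \<phi>_def[abs_def] side_def vert_def mode_phase_def kron_def phase3_def)
  ultimately show ?thesis
    by (simp only: profile_integral_def prod_3)
qed

lemma horiz_eq:
  assumes "c > 0" "p \<in> {0, 1}" "q \<in> {0, 1}"
  shows "horiz c m p n q = (if m = n \<and> p = q then (if m = 0 then (1 - p) * (2 * pi / c) else pi / c) else 0)"
  unfolding horiz_def using assms by (rule integral_trig_mult_trig)

lemma vert_eq:
  "vert m n k = pi / (4 * K $ 3) * (of_bool (int m - int n + int k = 0) + of_bool (int m - int n - int k = 0)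
      - of_bool (int m + int n + int k = 0) - of_bool (int m + int n - int k = 0))"
  unfolding vert_def using K_pos by (rule integral_sin_sin_cos)

end

section \<open>Horizontally constant temperature modes\<close>

text \<open>A zero horizontal wavenumber forces the cosine phase, so such a mode is determined by
  its vertical wavenumber alone.\<close>

lemma temp_modes_star_iff: "n \<in> temp_modes_star \<longleftrightarrow> wave n $ 3 > 0 \<and> n = vertical_mode (wave n $ 3)"
  by (cases n) (auto simp: temp_modes_star_def temp_modes_def temp_phases_def vertical_mode_def
      vec_eq_iff forall_3)

lemma wave_vertical_mode: "wave (vertical_mode m) $ 1 = 0" "wave (vertical_mode m) $ 2 = 0"
    "wave (vertical_mode m) $ 3 = m"
  by (simp_all add: vertical_mode_def)

lemma phase_vertical_mode: "phase (vertical_mode m) = (0, 0)"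
  by (simp add: vertical_mode_def)

text \<open>Each vertical wavenumber belongs to exactly one horizontally constant mode, so the sum
  counts whether that mode was selected.\<close>

lemma sum_temp_modes_star_of_bool:
  assumes "finite Nt" and "a > 0"
  shows "(\<Sum>s\<in>Nt \<inter> temp_modes_star. of_bool (wave s $ 3 = a)) = (of_bool (vertical_mode a \<in> Nt) :: real)"
proof -
  have "of_bool (wave s $ 3 = a) = (of_bool (s = vertical_mode a) :: real)"
    if "s \<in> temp_modes_star" for s
  proof -
    have "s = vertical_mode (wave s $ 3)"
      using that temp_modes_star_iff by blast
    then have "wave s $ 3 = a \<longleftrightarrow> s = vertical_mode a"
      by (metis wave_vertical_mode(3))
    then show ?thesis by simp
  qed
  then have "(\<Sum>s\<in>Nt \<inter> temp_modes_star. of_bool (wave s $ 3 = a))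
      = (\<Sum>s\<in>Nt \<inter> temp_modes_star. (of_bool (s = vertical_mode a) :: real))"
    by (intro sum.cong) auto
  also have "\<dots> = of_bool (vertical_mode a \<in> Nt \<inter> temp_modes_star)"
    using assms by (simp add: of_bool_def)
  also have "vertical_mode a \<in> temp_modes_star"
    using assms by (simp add: temp_modes_star_iff wave_vertical_mode)
  ultimately show ?thesis by simp
qed

lemma vel_modes_phase:
  assumes "n \<in> vel_modes"
  shows "fst (phase n) \<in> {0, 1}" "snd (phase n) \<in> {0, 1}"
  using assms by (auto simp: vel_modes_def vel_phases_def split: if_splits)

lemma temp_modes_phase:
  assumes "n \<in> temp_modes"
  shows "fst (phase n) \<in> {0, 1}" "snd (phase n) \<in> {0, 1}"
  using assms by (auto simp: temp_modes_def temp_phases_def split: if_splits)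

section \<open>Vertical flux and the Energy Balance Criterion\<close>

context box
begin

definition flux :: "mode \<Rightarrow> mode \<Rightarrow> real" where
  "flux n' n = bracket k1 k2 (\<lambda>x. vel_fun k1 k2 n' x $ 3 * temp_fun k1 k2 n x)"

lemma flux_eq: "flux n' n = vel_amp n' 3 * temp_amp n * profile_integral n' n 0"
proof -
  have "flux n' n = bracket k1 k2 (\<lambda>x. (vel_amp n' 3 * temp_amp n) *
      (profile K (wave n') (mode_phase n' 3) x * profile K (wave n) (mode_phase n 3) x *
        cos (0 * (K $ 3 * x $ 3))))"
    unfolding flux_def by (simp add: vel_fun_nth temp_fun_eq ac_simps)
  then show ?thesis
    using bracket_profile_profile_cos[of n' n 0] by (simp only: bracket_cmult) simp
qed

text \<open>The gradient of a horizontally constant mode is vertical and proportional to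
  \<open>cos (k * (K $ 3 * x $ 3))\<close>, so transport of this mode tests the flux density
  \<open>u\<^sub>3 f\<close> against a cosine.\<close>

lemma trilin_vertical_mode:
  assumes "s = vertical_mode k"
  shows "trilin n' s n = vel_amp n' 3 * temp_amp n * (temp_amp s * (K $ 3 * k)) * profile_integral n' n k"
proof -
  have "temp_grad s 1 x = 0" "temp_grad s 2 x = 0"
    "temp_grad s 3 x = temp_amp s * (K $ 3 * k) * cos (k * (K $ 3 * x $ 3))" for x
    using assms by (simp_all add: temp_grad_def wave_vertical_mode mode_phase_def kron_def phase3_def
        phase_vertical_mode profile_def prod_3 trig_def)
  then have "trilin n' s n = bracket k1 k2 (\<lambda>x. (vel_amp n' 3 * temp_amp n * (temp_amp s * (K $ 3 * k))) *
      (profile K (wave n') (mode_phase n' 3) x * profile K (wave n) (mode_phase n 3) x *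
        cos (k * (K $ 3 * x $ 3))))"
    unfolding trilin_def advect_temp_fun by (simp add: sum_3 vel_fun_nth temp_fun_eq ac_simps)
  then show ?thesis
    by (simp only: bracket_cmult bracket_profile_profile_cos)
qed

text \<open>For kind 1 the third entry of the cross product is \<open>k2 * m2 - k1 * m1\<close>.
  This explains the pairs that the criterion leaves out.\<close>

lemma vel_amp_3_eq_0:
  assumes "kind n = 1" "k1 * real (wave n $ 1) = k2 * real (wave n $ 2)"
  shows "vel_amp n 3 = 0"
  using assms by (simp add: vel_amp_def Gmat_def diag_def cross3_def gamma_vec_def Kwave_def
      matrix_vector_mult_def sum_3 wavenumbers_def)

text \<open>With a vanishing wavenumber only kind 1 is admissible, so \<open>vel_amp_3_eq_0\<close>
  applies.\<close>

lemma vel_amp_3_eq_0_horizontal: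
  assumes "n \<in> vel_modes" "wave n $ 1 = 0" "wave n $ 2 = 0"
  shows "vel_amp n 3 = 0"
  using assms by (intro vel_amp_3_eq_0) (auto simp: vel_modes_def vel_kinds_def forall_3 split: if_splits)

lemma profile_integral_eq_0:
  assumes "fst (phase n) \<in> {0, 1}" "snd (phase n) \<in> {0, 1}"
    and "fst (phase m) \<in> {0, 1}" "snd (phase m) \<in> {0, 1}"
    and "wave n $ 1 \<noteq> wave m $ 1 \<or> wave n $ 2 \<noteq> wave m $ 2 \<or> phase n \<noteq> phase m"
  shows "profile_integral n m k = 0"
  using assms K_pos by (auto simp: profile_integral_def horiz_eq prod_eq_iff)

text \<open>A velocity mode either has no vertical component or varies horizontally; in the latter
  case it is orthogonal to every horizontally constant function in the basis.\<close>

lemma flux_vertical_mode: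
  assumes "n' \<in> vel_modes" "s \<in> temp_modes_star"
  shows "flux n' s = 0"
proof (cases "wave n' $ 1 = 0 \<and> wave n' $ 2 = 0")
  case True
  then show ?thesis
    using vel_amp_3_eq_0_horizontal assms(1) by (simp add: flux_eq)
next
  case False
  have "s \<in> temp_modes" "wave s $ 1 = 0" "wave s $ 2 = 0"
    using assms(2) by (auto simp: temp_modes_star_def)
  then have "profile_integral n' s 0 = 0"
    using False vel_modes_phase[OF assms(1)] temp_modes_phase[of s]
    by (intro profile_integral_eq_0) auto
  then show ?thesis by (simp add: flux_eq)
qed

definition weight :: "mode \<Rightarrow> real" where
  "weight s = 2 / (temp_amp s * (K $ 3 * (wave s $ 3)))"

text \<open>With these weights \<open>\<Sum> weight s \<partial>\<^sub>3 f\<^sub>s = 2 \<Sum> cos (m k\<^sub>3 x\<^sub>3)\<close>. The full cosine series would be a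
  Dirac mass at the plates minus 1, and products of sines vanish there; the criterion makes the
  truncated series act in the same way.\<close>

lemma flux_eq_sum_trilin:
  assumes "finite Nt" "Nt \<subseteq> temp_modes" "Nu \<subseteq> vel_modes" "energy_balance k1 k2 Nu Nt"
    and n': "n' \<in> Nu" and n: "n \<in> Nt"
  shows "flux n' n = (\<Sum>s\<in>Nt \<inter> temp_modes_star. weight s * trilin n' n s)"
proof -
  let ?S = "Nt \<inter> temp_modes_star"
  \<comment> \<open>Skew-symmetry moves the derivative onto the mode \<open>s\<close>, and
    \<open>weight s\<close> then cancels its amplitude and wavenumber up to the factor 2.\<close>
  have trilin: "weight s * trilin n' n s
      = - (vel_amp n' 3 * temp_amp n * (2 * profile_integral n' n (wave s $ 3)))" if "s \<in> ?S" for s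
  proof -
    have "s = vertical_mode (wave s $ 3)" "wave s $ 3 > 0"
      using that temp_modes_star_iff by blast+
    then show ?thesis
      using trilin_vertical_mode[of s "wave s $ 3" n' n] K_pos[of 3] temp_amp_pos[of s]
      by (simp add: trilin_skew[of n' n s] weight_def)
  qed
  \<comment> \<open>This is the orthogonality of \<open>u\<^sub>3 f\<close> to one plus twice the
    sum of the selected cosines.\<close>
  have "vel_amp n' 3 * (profile_integral n' n 0 + 2 * (\<Sum>s\<in>?S. profile_integral n' n (wave s $ 3))) = 0"
  proof (cases "vel_amp n' 3 = 0 \<or>
      wave n' $ 1 \<noteq> wave n $ 1 \<or> wave n' $ 2 \<noteq> wave n $ 2 \<or> phase n' \<noteq> phase n")
    case True
    have "profile_integral n' n k = 0"
      if "wave n' $ 1 \<noteq> wave n $ 1 \<or> wave n' $ 2 \<noteq> wave n $ 2 \<or> phase n' \<noteq> phase n" for k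
      using assms that vel_modes_phase[of n'] temp_modes_phase[of n]
      by (intro profile_integral_eq_0) auto
    then show ?thesis
      using True by auto
  next
    case False
    define a b where "a = wave n' $ 3" and "b = wave n $ 3"
    have b: "b > 0"
      using n assms(2) by (auto simp: b_def temp_modes_def)
    have "n' \<in> vel_modes"
      using n' assms(3) by auto
    then have "kind n' \<in> {1, 2}"
      by (auto simp: vel_modes_def vel_kinds_def split: if_splits)
    \<comment> \<open>A nonzero vertical amplitude yields the last premise of the criterion.\<close>
    then have kind: "k1 * real (wave n' $ 1) \<noteq> k2 * real (wave n' $ 2) \<or> kind n' = 2"
      using False vel_amp_3_eq_0[of n'] by auto
    have "(wave n' $ 1, wave n' $ 2) \<noteq> (0, 0)"
      using False vel_amp_3_eq_0_horizontal[OF \<open>n' \<in> vel_modes\<close>] by auto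
    with assms(4) n' n False kind
    have bal: "a = b \<longrightarrow> vertical_mode (a + b) \<in> Nt"
      "a \<noteq> b \<longrightarrow> (vertical_mode (a + b) \<in> Nt \<longleftrightarrow> vertical_mode (nat \<bar>int a - int b\<bar>) \<in> Nt)"
      unfolding energy_balance_def Let_def a_def b_def by blast+
    have vert0: "vert a b 0 = pi / (4 * K $ 3) * (2 * of_bool (a = b))"
      using b by (auto simp: vert_eq)
    \<comment> \<open>For a positive third wavenumber the two difference resonances merge into one,
      and of the two sum resonances only the one at \<open>a + b\<close> can occur.\<close>
    have vert: "vert a b (wave s $ 3) = pi / (4 * K $ 3) *
        (of_bool (wave s $ 3 = nat \<bar>int a - int b\<bar>) - of_bool (wave s $ 3 = a + b))" if "s \<in> ?S" for s
    proof -
      have "wave s $ 3 > 0"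
        using that by (auto simp: temp_modes_star_def)
      then show ?thesis
        using b by (auto simp: vert_eq of_bool_def)
    qed
    \<comment> \<open>If \<open>a = b\<close>, the difference is 0, which is not the vertical
      wavenumber of any temperature mode, so the sum is empty of hits.\<close>
    have sum_diff: "(\<Sum>s\<in>?S. of_bool (wave s $ 3 = nat \<bar>int a - int b\<bar>))
        = (of_bool (a \<noteq> b \<and> vertical_mode (nat \<bar>int a - int b\<bar>) \<in> Nt) :: real)"
    proof (cases "a = b")
      case True
      have "of_bool (wave s $ 3 = nat \<bar>int a - int b\<bar>) = (0 :: real)" if "s \<in> ?S" for s
        using that True by (auto simp: temp_modes_star_def)
      then have "(\<Sum>s\<in>?S. of_bool (wave s $ 3 = nat \<bar>int a - int b\<bar>)) = (0 :: real)"
        by (rule sum.neutral[OF ballI])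
      then show ?thesis
        using True by simp
    next
      case False
      then show ?thesis
        using sum_temp_modes_star_of_bool[OF assms(1), of "nat \<bar>int a - int b\<bar>"] by simp
    qed
    have "(\<Sum>s\<in>?S. vert a b (wave s $ 3)) = pi / (4 * K $ 3) *
        (\<Sum>s\<in>?S. of_bool (wave s $ 3 = nat \<bar>int a - int b\<bar>) - of_bool (wave s $ 3 = a + b))"
      unfolding sum_distrib_left by (rule sum.cong[OF refl vert])
    also have "\<dots> = pi / (4 * K $ 3) * (of_bool (a \<noteq> b \<and> vertical_mode (nat \<bar>int a - int b\<bar>) \<in> Nt)
        - of_bool (vertical_mode (a + b) \<in> Nt))"
      using b sum_temp_modes_star_of_bool[OF assms(1), of "a + b"]
      by (simp only: sum_subtractf sum_diff)
    finally have sum_vert: "(\<Sum>s\<in>?S. vert a b (wave s $ 3)) = \<dots>" .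
    have "c * (2 * x) + 2 * (c * (y - z)) = 2 * c * (x + y - z)" for c x y z :: real
      by (simp add: algebra_simps)
    then have "vert a b 0 + 2 * (\<Sum>s\<in>?S. vert a b (wave s $ 3)) = 2 * (pi / (4 * K $ 3)) *
        (of_bool (a = b) + of_bool (a \<noteq> b \<and> vertical_mode (nat \<bar>int a - int b\<bar>) \<in> Nt)
          - of_bool (vertical_mode (a + b) \<in> Nt))"
      unfolding vert0 sum_vert by blast
    \<comment> \<open>If \<open>a = b\<close>, the mean contributes 1 and the mode at
      \<open>a + b\<close>, present by the criterion, removes it. Otherwise the two membership
      indicators agree and cancel.\<close>
    also have "\<dots> = 0"
      using bal by auto
    finally have "vert a b 0 + 2 * (\<Sum>s\<in>?S. vert a b (wave s $ 3)) = 0" .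
    moreover have "profile_integral n' n 0 + 2 * (\<Sum>s\<in>?S. profile_integral n' n (wave s $ 3))
        = horiz (K $ 1) (wave n' $ 1) (fst (phase n')) (wave n $ 1) (fst (phase n)) *
          horiz (K $ 2) (wave n' $ 2) (snd (phase n')) (wave n $ 2) (snd (phase n)) *
          (vert a b 0 + 2 * (\<Sum>s\<in>?S. vert a b (wave s $ 3)))"
      unfolding profile_integral_def a_def b_def
      by (simp add: distrib_left mult.left_commute flip: sum_distrib_left)
    ultimately show ?thesis
      by simp
  qed
  then have "0 = temp_amp n * (vel_amp n' 3 *
      (profile_integral n' n 0 + 2 * (\<Sum>s\<in>?S. profile_integral n' n (wave s $ 3))))"
    by simp
  also have "\<dots> = flux n' n - (\<Sum>s\<in>?S. weight s * trilin n' n s)"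
    by (simp add: trilin flux_eq sum_negf algebra_simps flip: sum_distrib_left)
  finally show ?thesis by simp
qed

section \<open>Orthogonality and independence of the temperature modes\<close>

lemma bracket_temp_fun_temp_fun:
  "bracket k1 k2 (\<lambda>x. temp_fun k1 k2 n x * temp_fun k1 k2 m x)
    = temp_amp n * temp_amp m * profile_integral n m 0"
proof -
  have "bracket k1 k2 (\<lambda>x. temp_fun k1 k2 n x * temp_fun k1 k2 m x)
      = bracket k1 k2 (\<lambda>x. (temp_amp n * temp_amp m) *
      (profile K (wave n) (mode_phase n 3) x * profile K (wave m) (mode_phase m 3) x *
        cos (0 * (K $ 3 * x $ 3))))"
    by (simp add: temp_fun_eq ac_simps)
  then show ?thesis
    using bracket_profile_profile_cos[of n m 0] by (simp only: bracket_cmult) simp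
qed

lemma bracket_temp_fun_orthogonal:
  assumes "n \<in> temp_modes" "m \<in> temp_modes" "n \<noteq> m"
  shows "bracket k1 k2 (\<lambda>x. temp_fun k1 k2 n x * temp_fun k1 k2 m x) = 0"
proof -
  have "kind n = kind m"
    using assms by (simp add: temp_modes_def)
  then have "wave n \<noteq> wave m \<or> phase n \<noteq> phase m"
    using assms(3) by (metis mode.exhaust_sel)
  then consider "wave n $ 1 \<noteq> wave m $ 1 \<or> wave n $ 2 \<noteq> wave m $ 2 \<or> phase n \<noteq> phase m" | "wave n $ 3 \<noteq> wave m $ 3"
    by (auto simp: vec_eq_iff forall_3)
  then have "profile_integral n m 0 = 0"
  proof cases
    case 1
    then show ?thesis
      using temp_modes_phase[OF assms(1)] temp_modes_phase[OF assms(2)] by (intro profile_integral_eq_0)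
  next
    case 2
    moreover have "wave n $ 3 > 0"
      using assms(1) by (simp add: temp_modes_def)
    ultimately show ?thesis
      by (simp add: profile_integral_def vert_eq)
  qed
  then show ?thesis
    by (simp add: bracket_temp_fun_temp_fun)
qed

text \<open>Admissible phases exclude a horizontal sine of wavenumber 0, so no factor is the zero
  function.\<close>

lemma bracket_temp_fun_square:
  assumes "n \<in> temp_modes"
  shows "bracket k1 k2 (\<lambda>x. temp_fun k1 k2 n x * temp_fun k1 k2 n x) \<noteq> 0"
proof -
  have "wave n $ 3 > 0" "wave n $ 1 = 0 \<longrightarrow> fst (phase n) = 0" "wave n $ 2 = 0 \<longrightarrow> snd (phase n) = 0"
    using assms by (auto simp: temp_modes_def temp_phases_def split: if_splits)
  then have "profile_integral n n 0 \<noteq> 0"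
    using K_pos[of 1] K_pos[of 2] K_pos[of 3] temp_modes_phase[OF assms]
    by (simp add: profile_integral_def horiz_eq vert_eq)
  then show ?thesis
    using temp_amp_pos[of n] by (simp add: bracket_temp_fun_temp_fun)
qed

text \<open>Pairing with \<open>temp_fun k1 k2 m\<close> isolates one coefficient. This is how an
  identity between fields on \<open>Omega\<close> becomes one between coefficients.\<close>

lemma temp_fun_independent:
  assumes "finite Nt" "Nt \<subseteq> temp_modes" "m \<in> Nt"
    and eq: "\<And>x. x \<in> Omega k1 k2 \<Longrightarrow>
      (\<Sum>n\<in>Nt. d n * temp_fun k1 k2 n x) = (\<Sum>n\<in>Nt. e n * temp_fun k1 k2 n x)"
  shows "d m = e m"
proof -
  have coeff: "bracket k1 k2 (\<lambda>x. (\<Sum>n\<in>Nt. d n * temp_fun k1 k2 n x) * temp_fun k1 k2 m x)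
      = d m * bracket k1 k2 (\<lambda>x. temp_fun k1 k2 m x * temp_fun k1 k2 m x)" for d
  proof -
    have "bracket k1 k2 (\<lambda>x. (\<Sum>n\<in>Nt. d n * temp_fun k1 k2 n x) * temp_fun k1 k2 m x)
        = bracket k1 k2 (\<lambda>x. \<Sum>n\<in>Nt. d n * (temp_fun k1 k2 n x * temp_fun k1 k2 m x))"
      by (simp add: sum_distrib_right mult.assoc)
    also have "\<dots> = (\<Sum>n\<in>Nt. d n * bracket k1 k2 (\<lambda>x. temp_fun k1 k2 n x * temp_fun k1 k2 m x))"
      using assms(1) by (intro bracket_lincomb continuous_intros)
    also have "\<dots> = (\<Sum>n\<in>Nt. if n = m then d n * bracket k1 k2 (\<lambda>x. temp_fun k1 k2 n x * temp_fun k1 k2 m x) else 0)"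
      using assms(2,3) bracket_temp_fun_orthogonal by (intro sum.cong) auto
    also have "\<dots> = d m * bracket k1 k2 (\<lambda>x. temp_fun k1 k2 m x * temp_fun k1 k2 m x)"
      using assms(1,3) by simp
    finally show ?thesis .
  qed
  have "bracket k1 k2 (\<lambda>x. (\<Sum>n\<in>Nt. d n * temp_fun k1 k2 n x) * temp_fun k1 k2 m x)
      = bracket k1 k2 (\<lambda>x. (\<Sum>n\<in>Nt. e n * temp_fun k1 k2 n x) * temp_fun k1 k2 m x)"
    unfolding bracket_def using eq by (intro integral_cong) simp
  then show ?thesis
    using bracket_temp_fun_square[of m] assms(2,3) unfolding coeff by auto
qed

section \<open>The temperature equation in coefficients\<close>

definition lam :: "mode \<Rightarrow> real" where
  "lam n = (\<Sum>i\<in>UNIV. (K $ i * (wave n $ i))\<^sup>2)"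

lemma pd_temp_field:
  "pd i (temp_field k1 k2 Nt b) = (\<lambda>x. \<Sum>n\<in>Nt. b n * temp_grad n i x)"
  unfolding temp_field_def[abs_def]
  by (intro has_pd_imp_pd has_pd_sum has_pd_cmult has_pd_temp_fun)

lemma laplace_temp_field:
  "laplace (temp_field k1 k2 Nt b) x = (\<Sum>n\<in>Nt. (- lam n * b n) * temp_fun k1 k2 n x)"
proof -
  have "pd i (pd i (temp_field k1 k2 Nt b)) x
      = (\<Sum>n\<in>Nt. b n * (- (K $ i * (wave n $ i))\<^sup>2 * temp_fun k1 k2 n x))" for i
    unfolding pd_temp_field
    by (subst has_pd_imp_pd[OF has_pd_sum[OF has_pd_cmult[OF has_pd_temp_grad]]]) simp
  then have "laplace (temp_field k1 k2 Nt b) x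
      = (\<Sum>i\<in>UNIV. \<Sum>n\<in>Nt. b n * (- (K $ i * (wave n $ i))\<^sup>2 * temp_fun k1 k2 n x))"
    by (simp add: laplace_def)
  also have "\<dots> = (\<Sum>n\<in>Nt. \<Sum>i\<in>UNIV. b n * (- (K $ i * (wave n $ i))\<^sup>2 * temp_fun k1 k2 n x))"
    by (rule sum.swap)
  also have "\<dots> = (\<Sum>n\<in>Nt. (- lam n * b n) * temp_fun k1 k2 n x)"
    by (simp add: lam_def sum_3 algebra_simps)
  finally show ?thesis .
qed

lemma vel_field_nth: "vel_field k1 k2 Nu a x $ i = (\<Sum>n\<in>Nu. a n * vel_fun k1 k2 n x $ i)"
  by (simp add: vel_field_def)

lemma advect_fields:
  "advect (vel_field k1 k2 Nu a) (temp_field k1 k2 Nt b) x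
    = (\<Sum>n'\<in>Nu. a n' * (\<Sum>n\<in>Nt. b n * advect (vel_fun k1 k2 n') (temp_fun k1 k2 n) x))"
proof -
  have "advect (vel_field k1 k2 Nu a) (temp_field k1 k2 Nt b) x
      = (\<Sum>i\<in>UNIV. \<Sum>n'\<in>Nu. \<Sum>n\<in>Nt. a n' * b n * (vel_fun k1 k2 n' x $ i * temp_grad n i x))"
    unfolding advect_def pd_temp_field vel_field_nth sum_product by (simp only: ac_simps)
  also have "\<dots> = (\<Sum>n'\<in>Nu. \<Sum>n\<in>Nt. \<Sum>i\<in>UNIV. a n' * b n * (vel_fun k1 k2 n' x $ i * temp_grad n i x))"
    by (subst sum.swap, rule sum.cong[OF refl], rule sum.swap)
  also have "\<dots> = (\<Sum>n'\<in>Nu. a n' * (\<Sum>n\<in>Nt. b n * advect (vel_fun k1 k2 n') (temp_fun k1 k2 n) x))"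
    by (simp add: advect_temp_fun sum_distrib_left mult.assoc)
  finally show ?thesis .
qed

text \<open>The right-hand side of the ODE for the temperature coefficient \<open>m\<close>:
  diffusion, forcing by vertical velocity, transport. \<open>R\<close> and \<open>S\<close> do not
  occur in it, which makes the final bound uniform in them.\<close>

definition temp_rate :: "mode set \<Rightarrow> mode set \<Rightarrow> (mode \<Rightarrow> real) \<Rightarrow> (mode \<Rightarrow> real) \<Rightarrow> mode \<Rightarrow> real" where
  "temp_rate Nu Nt a b m = - lam m * b m + (\<Sum>n'\<in>Nu. a n' * flux n' m)
     - (\<Sum>n'\<in>Nu. a n' * (\<Sum>n\<in>Nt. b n * trilin n' n m))"

lemma temp_rhs_eq:
  assumes "finite Nu" "finite Nt"
  shows "temp_rhs k1 k2 Nt (vel_field k1 k2 Nu a) (temp_field k1 k2 Nt b) x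
    = (\<Sum>m\<in>Nt. temp_rate Nu Nt a b m * temp_fun k1 k2 m x)"
proof -
  have "bracket k1 k2 (\<lambda>y. vel_field k1 k2 Nu a y $ 3 * temp_fun k1 k2 m y)
      = (\<Sum>n'\<in>Nu. a n' * flux n' m)" for m
    unfolding vel_field_nth sum_distrib_right flux_def mult.assoc
    using assms by (intro bracket_lincomb continuous_intros)
  moreover have "bracket k1 k2 (\<lambda>y. advect (vel_field k1 k2 Nu a) (temp_field k1 k2 Nt b) y * temp_fun k1 k2 m y)
      = (\<Sum>n'\<in>Nu. a n' * (\<Sum>n\<in>Nt. b n * trilin n' n m))" for m
  proof -
    have inner: "bracket k1 k2 (\<lambda>y. \<Sum>n\<in>Nt. b n *
          (advect (vel_fun k1 k2 n') (temp_fun k1 k2 n) y * temp_fun k1 k2 m y))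
        = (\<Sum>n\<in>Nt. b n * trilin n' n m)" for n'
      unfolding trilin_def using assms by (intro bracket_lincomb continuous_intros)
    have "bracket k1 k2 (\<lambda>y. advect (vel_field k1 k2 Nu a) (temp_field k1 k2 Nt b) y * temp_fun k1 k2 m y)
      = (\<Sum>n'\<in>Nu. a n' * bracket k1 k2 (\<lambda>y. \<Sum>n\<in>Nt. b n *
          (advect (vel_fun k1 k2 n') (temp_fun k1 k2 n) y * temp_fun k1 k2 m y)))"
      unfolding advect_fields sum_distrib_right mult.assoc
      using assms by (intro bracket_lincomb continuous_intros)
    then show ?thesis
      unfolding inner .
  qed
  ultimately show ?thesis
    by (simp add: temp_rhs_def temp_proj_def laplace_temp_field temp_rate_def
        left_diff_distrib distrib_right sum.distrib sum_subtractf sum_negf)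
qed

lemma heat_flux_eq:
  assumes "finite Nu" "finite Nt"
  shows "heat_flux k1 k2 Nu Nt a b = (\<Sum>n'\<in>Nu. a n' * (\<Sum>n\<in>Nt. b n * flux n' n))"
proof -
  have inner: "bracket k1 k2 (\<lambda>x. \<Sum>n\<in>Nt. b n * (vel_fun k1 k2 n' x $ 3 * temp_fun k1 k2 n x))
      = (\<Sum>n\<in>Nt. b n * flux n' n)" for n'
    unfolding flux_def using assms by (intro bracket_lincomb continuous_intros)
  have "heat_flux k1 k2 Nu Nt a b = bracket k1 k2 (\<lambda>x. \<Sum>n'\<in>Nu. a n' *
      (\<Sum>n\<in>Nt. b n * (vel_fun k1 k2 n' x $ 3 * temp_fun k1 k2 n x)))"
    unfolding heat_flux_def vel_field_nth temp_field_def sum_product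
    by (simp only: sum_distrib_left ac_simps)
  also have "\<dots> = (\<Sum>n'\<in>Nu. a n' * bracket k1 k2 (\<lambda>x.
      \<Sum>n\<in>Nt. b n * (vel_fun k1 k2 n' x $ 3 * temp_fun k1 k2 n x)))"
    using assms by (intro bracket_lincomb continuous_intros)
  finally show ?thesis
    unfolding inner .
qed

end

subsection \<open>Balance laws and the bound\<close>

context box
begin

text \<open>The wavenumber cancels between the eigenvalue and the weight, so every horizontally
  constant mode contributes the same constant to the bound.\<close>

lemma weight_square:
  assumes "s \<in> temp_modes_star"
  shows "lam s * (weight s)\<^sup>2 = 8 * pi ^ 3"
proof -
  obtain k where s: "s = vertical_mode k" and k: "k > 0"
    using assms temp_modes_star_iff by blast
  have "temp_amp s = sqrt 2 / Vnorm"
    using k by (simp add: temp_amp_def eta_def prod_3 s wave_vertical_mode iota_def)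
  then have "(temp_amp s)\<^sup>2 = 2 / (4 * pi ^ 3)"
    by (simp add: Vnorm_def power_divide)
  moreover have "lam s = (K $ 3 * k)\<^sup>2"
    by (simp add: lam_def sum_3 s wave_vertical_mode)
  moreover have "(weight s)\<^sup>2 = 4 / ((temp_amp s)\<^sup>2 * (K $ 3 * k)\<^sup>2)"
    by (simp add: weight_def s wave_vertical_mode power_divide power_mult_distrib)
  ultimately show ?thesis
    using k K_pos[of 3] by simp
qed

lemma lam_nonneg: "lam n \<ge> 0"
  by (simp add: lam_def sum_nonneg)

text \<open>The forcing vanishes in the equation of a horizontally constant mode, so its rate and
  diffusion give exactly the transport term. The weighted sum of these terms is the heat flux by
  \<open>flux_eq_sum_trilin\<close>.\<close>

lemma heat_flux_eq_temp_rate: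
  assumes fin: "finite Nu" "finite Nt" and sub: "Nt \<subseteq> temp_modes" "Nu \<subseteq> vel_modes"
    and bal: "energy_balance k1 k2 Nu Nt"
  shows "heat_flux k1 k2 Nu Nt a b
    = - (\<Sum>s\<in>Nt \<inter> temp_modes_star. weight s * (temp_rate Nu Nt a b s + lam s * b s))"
proof -
  let ?S = "Nt \<inter> temp_modes_star"
  have rate: "temp_rate Nu Nt a b s + lam s * b s = - (\<Sum>n'\<in>Nu. \<Sum>n\<in>Nt. a n' * b n * trilin n' n s)"
    if "s \<in> ?S" for s
  proof -
    have "(\<Sum>n'\<in>Nu. a n' * flux n' s) = 0"
      using that sub flux_vertical_mode by (intro sum.neutral) auto
    then show ?thesis
      by (simp add: temp_rate_def sum_distrib_left mult.assoc)
  qed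
  have "heat_flux k1 k2 Nu Nt a b = (\<Sum>n'\<in>Nu. \<Sum>n\<in>Nt. a n' * b n * flux n' n)"
    by (simp add: heat_flux_eq[OF fin] sum_distrib_left mult.assoc)
  also have "\<dots> = (\<Sum>n'\<in>Nu. \<Sum>n\<in>Nt. \<Sum>s\<in>?S. weight s * (a n' * b n * trilin n' n s))"
    using flux_eq_sum_trilin[OF fin(2) sub bal] by (simp add: sum_distrib_left ac_simps)
  also have "\<dots> = (\<Sum>n'\<in>Nu. \<Sum>s\<in>?S. \<Sum>n\<in>Nt. weight s * (a n' * b n * trilin n' n s))"
    by (rule sum.cong[OF refl], rule sum.swap)
  also have "\<dots> = (\<Sum>s\<in>?S. \<Sum>n'\<in>Nu. \<Sum>n\<in>Nt. weight s * (a n' * b n * trilin n' n s))"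
    by (rule sum.swap)
  also have "\<dots> = - (\<Sum>s\<in>?S. weight s * (temp_rate Nu Nt a b s + lam s * b s))"
    by (simp add: rate sum_negf sum_distrib_left)
  finally show ?thesis .
qed

text \<open>The energy balance: transport drops out by skew-symmetry, and the forcing tested with
  the temperature is the heat flux.\<close>

lemma temp_energy_rate:
  assumes fin: "finite Nu" "finite Nt"
  shows "(\<Sum>m\<in>Nt. b m * temp_rate Nu Nt a b m)
    = heat_flux k1 k2 Nu Nt a b - (\<Sum>m\<in>Nt. lam m * (b m)\<^sup>2)"
proof -
  have skew: "(\<Sum>m\<in>Nt. \<Sum>n\<in>Nt. b m * b n * trilin n' n m) = 0" for n'
  proof -
    have "(\<Sum>m\<in>Nt. \<Sum>n\<in>Nt. b m * b n * trilin n' n m) = (\<Sum>m\<in>Nt. \<Sum>n\<in>Nt. b n * b m * trilin n' m n)"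
      by (rule sum.swap)
    also have "\<dots> = - (\<Sum>m\<in>Nt. \<Sum>n\<in>Nt. b m * b n * trilin n' n m)"
      by (subst trilin_skew) (simp add: sum_negf mult.commute)
    finally show ?thesis by simp
  qed
  have "(\<Sum>m\<in>Nt. b m * (\<Sum>n'\<in>Nu. a n' * (\<Sum>n\<in>Nt. b n * trilin n' n m)))
      = (\<Sum>m\<in>Nt. \<Sum>n'\<in>Nu. a n' * (\<Sum>n\<in>Nt. b m * b n * trilin n' n m))"
    by (simp add: sum_distrib_left ac_simps)
  also have "\<dots> = (\<Sum>n'\<in>Nu. \<Sum>m\<in>Nt. a n' * (\<Sum>n\<in>Nt. b m * b n * trilin n' n m))"
    by (rule sum.swap)
  also have "\<dots> = 0"
    by (simp add: skew flip: sum_distrib_left)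
  finally have "(\<Sum>m\<in>Nt. b m * (\<Sum>n'\<in>Nu. a n' * (\<Sum>n\<in>Nt. b n * trilin n' n m))) = 0" .
  moreover have "(\<Sum>m\<in>Nt. b m * (\<Sum>n'\<in>Nu. a n' * flux n' m)) = heat_flux k1 k2 Nu Nt a b"
  proof -
    have "(\<Sum>m\<in>Nt. b m * (\<Sum>n'\<in>Nu. a n' * flux n' m)) = (\<Sum>m\<in>Nt. \<Sum>n'\<in>Nu. a n' * (b m * flux n' m))"
      by (simp add: sum_distrib_left ac_simps)
    also have "\<dots> = (\<Sum>n'\<in>Nu. \<Sum>m\<in>Nt. a n' * (b m * flux n' m))"
      by (rule sum.swap)
    finally show ?thesis
      by (simp add: heat_flux_eq[OF fin] sum_distrib_left)
  qed
  moreover have "b m * temp_rate Nu Nt a b m = b m * (\<Sum>n'\<in>Nu. a n' * flux n' m)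
      - b m * (\<Sum>n'\<in>Nu. a n' * (\<Sum>n\<in>Nt. b n * trilin n' n m)) - lam m * (b m)\<^sup>2" for m
    by (simp add: temp_rate_def right_diff_distrib distrib_left power2_eq_square)
  ultimately show ?thesis
    by (simp add: sum_subtractf)
qed

section \<open>From solutions to time averages\<close>

text \<open>A solution satisfies the equation pointwise in \<open>x\<close>. The coefficients have
  some derivatives, and comparing the two expansions of the field derivative identifies
  them.\<close>

lemma temp_coefficient_derivative:
  assumes fin: "finite Nu" "finite Nt" and sub: "Nt \<subseteq> temp_modes"
    and sol: "model_solution k1 k2 P R S Nu Nt u0 th0 u th"
    and "t \<ge> 0" and m: "m \<in> Nt"
  shows "((\<lambda>s. th s m) has_real_derivative temp_rate Nu Nt (u t) (th t) m) (at t within {0..})"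
proof -
  have "\<forall>n\<in>Nt. \<exists>d. ((\<lambda>s. th s n) has_real_derivative d) (at t within {0..})"
    using sol \<open>t \<ge> 0\<close> unfolding model_solution_def differentiable_on_def
    by (auto simp: real_differentiable_def)
  then obtain d where d: "\<And>n. n \<in> Nt \<Longrightarrow> ((\<lambda>s. th s n) has_real_derivative d n) (at t within {0..})"
    by metis
  \<comment> \<open>Derivatives are unique only along a nontrivial filter; approach from the right
    ensures this also at \<open>t = 0\<close>.\<close>
  have "at_right t \<le> at t within {0..}"
    using \<open>t \<ge> 0\<close> by (intro at_le) auto
  then have not_bot: "at t within {0..} \<noteq> bot"
    using trivial_limit_at_right_real[of t] le_bot by metis
  have "(\<Sum>n\<in>Nt. d n * temp_fun k1 k2 n x) = (\<Sum>n\<in>Nt. temp_rate Nu Nt (u t) (th t) n * temp_fun k1 k2 n x)"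
    if "x \<in> Omega k1 k2" for x
  proof -
    have "((\<lambda>s. temp_field k1 k2 Nt (th s) x) has_real_derivative (\<Sum>n\<in>Nt. d n * temp_fun k1 k2 n x))
        (at t within {0..})"
      unfolding temp_field_def by (auto intro!: DERIV_sum DERIV_cmult_right d)
    moreover have "((\<lambda>s. temp_field k1 k2 Nt (th s) x) has_real_derivative
        (\<Sum>n\<in>Nt. temp_rate Nu Nt (u t) (th t) n * temp_fun k1 k2 n x)) (at t within {0..})"
      using sol \<open>t \<ge> 0\<close> that unfolding model_solution_def by (simp add: temp_rhs_eq[OF fin])
    ultimately show ?thesis
      using not_bot by (rule has_field_derivative_unique)
  qed
  then have "d m = temp_rate Nu Nt (u t) (th t) m"
    by (rule temp_fun_independent[OF fin(2) sub m])
  then show ?thesis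
    using d[OF m] by simp
qed

text \<open>Time integration of a pointwise bound of the flux by a total derivative plus a constant.
  \<open>M\<close> may depend on the initial data, the slope in \<open>t\<close> does not.\<close>

lemma integral_heat_flux_le:
  assumes fin: "finite Nu" "finite Nt" and sub: "Nt \<subseteq> temp_modes" "Nu \<subseteq> vel_modes"
    and bal: "energy_balance k1 k2 Nu Nt"
    and sol: "model_solution k1 k2 P R S Nu Nt u0 th0 u th"
  shows "\<exists>M. \<forall>t\<ge>0. integral {0..t} (\<lambda>s. heat_flux k1 k2 Nu Nt (u s) (th s))
    \<le> M + 8 * pi ^ 3 * card (Nt \<inter> temp_modes_star) * t"
proof -
  let ?S = "Nt \<inter> temp_modes_star"
  let ?F = "\<lambda>s. heat_flux k1 k2 Nu Nt (u s) (th s)"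
  let ?B = "8 * pi ^ 3 * real (card ?S)"
  \<comment> \<open>Along solutions the linear part contributes twice the flux and the quadratic
    part minus the flux, apart from diffusion terms. The factors -2 and 1/2 thus leave one
    flux.\<close>
  define \<Phi> where "\<Phi> t = - 2 * (\<Sum>s\<in>?S. weight s * th t s) - (\<Sum>n\<in>Nt. (th t n)\<^sup>2) / 2" for t
  define \<Phi>' where "\<Phi>' t = - 2 * (\<Sum>s\<in>?S. weight s * temp_rate Nu Nt (u t) (th t) s)
      - (\<Sum>n\<in>Nt. th t n * temp_rate Nu Nt (u t) (th t) n)" for t
  have finS: "finite ?S" using fin by simp
  have deriv: "(\<Phi> has_real_derivative \<Phi>' t) (at t within {0..})" if "t \<ge> 0" for t
  proof -
    note D = temp_coefficient_derivative[OF fin sub(1) sol that]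
    have 1: "((\<lambda>t. \<Sum>s\<in>?S. weight s * th t s) has_real_derivative
        (\<Sum>s\<in>?S. weight s * temp_rate Nu Nt (u t) (th t) s)) (at t within {0..})"
      by (intro DERIV_sum DERIV_cmult D) auto
    have "((\<lambda>t. (th t n)\<^sup>2) has_real_derivative 2 * (th t n * temp_rate Nu Nt (u t) (th t) n))
        (at t within {0..})" if "n \<in> Nt" for n
      using D[OF that] by (auto intro!: derivative_eq_intros)
    then have "((\<lambda>t. \<Sum>n\<in>Nt. (th t n)\<^sup>2) has_real_derivative
        (\<Sum>n\<in>Nt. 2 * (th t n * temp_rate Nu Nt (u t) (th t) n))) (at t within {0..})"
      by (rule DERIV_sum)
    from DERIV_cdivide[OF this, of 2]
    have 2: "((\<lambda>t. (\<Sum>n\<in>Nt. (th t n)\<^sup>2) / 2) has_real_derivative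
        (\<Sum>n\<in>Nt. th t n * temp_rate Nu Nt (u t) (th t) n)) (at t within {0..})"
      by (simp flip: sum_distrib_left)
    show ?thesis
      unfolding \<Phi>_def \<Phi>'_def by (intro DERIV_diff DERIV_cmult 1 2)
  qed
  have le: "?F t \<le> \<Phi>' t + ?B" for t
  proof -
    have "\<Phi>' t = ?F t + (\<Sum>s\<in>?S. lam s * (2 * (weight s * th t s))) + (\<Sum>n\<in>Nt. lam n * (th t n)\<^sup>2)"
      unfolding \<Phi>'_def temp_energy_rate[OF fin]
      using heat_flux_eq_temp_rate[OF fin sub bal, of "u t" "th t"]
      by (simp add: distrib_left sum.distrib sum_distrib_left sum_negf ac_simps)
    moreover have "(\<Sum>s\<in>?S. lam s * (th t s)\<^sup>2) \<le> (\<Sum>n\<in>Nt. lam n * (th t n)\<^sup>2)"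
      using fin by (intro sum_mono2) (auto simp: lam_nonneg)
    moreover have "(\<Sum>s\<in>?S. - (lam s * (2 * (weight s * th t s))) - lam s * (th t s)\<^sup>2)
        \<le> (\<Sum>s\<in>?S. 8 * pi ^ 3)"
    proof (rule sum_mono)
      fix s assume "s \<in> ?S"
      \<comment> \<open>Completing the square: the linear diffusion term is absorbed by the
        dissipation of the same mode at the cost of
        \<open>lam s * (weight s)\<^sup>2\<close>.\<close>
      have "0 \<le> lam s * (weight s + th t s)\<^sup>2"
        by (simp add: lam_nonneg)
      then show "- (lam s * (2 * (weight s * th t s))) - lam s * (th t s)\<^sup>2 \<le> 8 * pi ^ 3"
        using weight_square[of s] \<open>s \<in> ?S\<close> by (simp add: power2_eq_square algebra_simps)
    qed
    ultimately show ?thesis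
      by (simp add: sum_subtractf sum_negf mult.commute)
  qed
  have \<Phi>_le: "\<Phi> t \<le> (\<Sum>s\<in>?S. 2 * (weight s)\<^sup>2)" for t
  proof -
    have "(\<Sum>s\<in>?S. (th t s)\<^sup>2) \<le> (\<Sum>n\<in>Nt. (th t n)\<^sup>2)"
      using fin by (intro sum_mono2) auto
    then have "\<Phi> t \<le> (\<Sum>s\<in>?S. - 2 * (weight s * th t s) - (th t s)\<^sup>2 / 2)"
      unfolding \<Phi>_def sum_subtractf sum_distrib_left sum_divide_distrib[symmetric] by simp
    also have "\<dots> \<le> (\<Sum>s\<in>?S. 2 * (weight s)\<^sup>2)"
    proof (rule sum_mono)
      fix s
      \<comment> \<open>The quadratic part of \<open>\<Phi>\<close> dominates its linear part, so
        \<open>\<Phi>\<close> is bounded above without any a priori bound on the solution.\<close>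
      have "0 \<le> (2 * weight s + th t s)\<^sup>2"
        by simp
      then show "- 2 * (weight s * th t s) - (th t s)\<^sup>2 / 2 \<le> 2 * (weight s)\<^sup>2"
        by (simp add: power2_eq_square algebra_simps)
    qed
    finally show ?thesis .
  qed
  have "integral {0..t} ?F \<le> ((\<Sum>s\<in>?S. 2 * (weight s)\<^sup>2) - \<Phi> 0) + ?B * t" if "t \<ge> 0" for t
  proof -
    have cont: "continuous_on {0..t} (\<lambda>s. u s n)" if "n \<in> Nu" for n
      using sol that unfolding model_solution_def
      by (intro continuous_on_subset[OF differentiable_imp_continuous_on, of _ "{0..}"]) auto
    have cont': "continuous_on {0..t} (\<lambda>s. th s n)" if "n \<in> Nt" for n
      using sol that unfolding model_solution_def
      by (intro continuous_on_subset[OF differentiable_imp_continuous_on, of _ "{0..}"]) auto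
    have "continuous_on {0..t} ?F"
      unfolding heat_flux_eq[OF fin] by (intro continuous_intros cont cont')
    then have intF: "?F integrable_on {0..t}"
      by (rule integrable_continuous_real)
    have "(\<Phi>' has_integral \<Phi> t - \<Phi> 0) {0..t}"
      using that by (intro fundamental_theorem_of_calculus)
        (auto simp flip: has_real_derivative_iff_has_vector_derivative intro!: DERIV_subset[OF deriv])
    moreover have "((\<lambda>s. ?B) has_integral ?B * t) {0..t}"
      using has_integral_const_real[of ?B 0 t] that by (simp add: mult.commute)
    ultimately have "((\<lambda>s. \<Phi>' s + ?B) has_integral (\<Phi> t - \<Phi> 0) + ?B * t) {0..t}"
      by (rule has_integral_add)
    with integrable_integral[OF intF] have "integral {0..t} ?F \<le> (\<Phi> t - \<Phi> 0) + ?B * t"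
      by (rule has_integral_le) (rule le)
    then show ?thesis
      using \<Phi>_le[of t] by simp
  qed
  then show ?thesis by blast
qed

text \<open>After division by \<open>t\<close> the initial data disappear in the limit, and
  \<open>8 * pi ^ 3\<close> per mode divided by \<open>4 * pi ^ 4\<close> is
  \<open>2 / pi\<close>.\<close>

lemma nusselt_le:
  assumes fin: "finite Nu" "finite Nt" and sub: "Nt \<subseteq> temp_modes" "Nu \<subseteq> vel_modes"
    and bal: "energy_balance k1 k2 Nu Nt"
    and sol: "model_solution k1 k2 P R S Nu Nt u0 th0 u th"
  shows "nusselt k1 k2 Nu Nt u th \<le> ereal (1 + 2 / pi * card (Nt \<inter> temp_modes_star))"
proof -
  let ?F = "\<lambda>s. heat_flux k1 k2 Nu Nt (u s) (th s)"
  let ?B = "8 * pi ^ 3 * real (card (Nt \<inter> temp_modes_star))"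
  obtain M where M: "\<And>t. t \<ge> 0 \<Longrightarrow> integral {0..t} ?F \<le> M + ?B * t"
    using integral_heat_flux_le[OF assms] by blast
  have "1 / t * integral {0..t} ?F \<le> M / t + ?B" if "t > 0" for t
    using mult_left_mono[OF M[of t], of "1 / t"] that by (simp add: field_simps)
  then have "\<forall>\<^sub>F t in at_top. ereal (1 / t * integral {0..t} ?F) \<le> ereal (M / t + ?B)"
    by (intro eventually_mono[OF eventually_gt_at_top[of 0]]) simp
  then have "Limsup at_top (\<lambda>t. ereal (1 / t * integral {0..t} ?F)) \<le> Limsup at_top (\<lambda>t. ereal (M / t + ?B))"
    by (rule Limsup_mono)
  also have "\<dots> = ereal ?B"
  proof (rule lim_imp_Limsup)
    have "((\<lambda>t. M / t + ?B) \<longlongrightarrow> 0 + ?B) at_top"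
      by (intro tendsto_add tendsto_const tendsto_divide_0[OF tendsto_const]
          filterlim_at_top_imp_at_infinity filterlim_ident)
    then show "((\<lambda>t. ereal (M / t + ?B)) \<longlongrightarrow> ereal ?B) at_top"
      by (intro tendsto_ereal) simp
  qed simp
  finally have "nusselt k1 k2 Nu Nt u th \<le> 1 + ereal (1 / (4 * pi ^ 4)) * ereal ?B"
    unfolding nusselt_def by (intro add_left_mono ereal_mult_left_mono) auto
  also have "\<dots> = ereal (1 + 2 / pi * card (Nt \<inter> temp_modes_star))"
    by (simp add: one_ereal_def eval_nat_numeral)
  finally show ?thesis .
qed

end

text \<open>Allows the maximum to be inserted as a factor in the final bound.\<close>

lemma max_vertical_ge_1:
  assumes "finite A" "A \<subseteq> temp_modes_star"
  shows "max_vertical A \<ge> 1"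
proof (cases "A = {}")
  case False
  then obtain n where n: "n \<in> A" by auto
  then have "wave n $ 3 \<ge> 1"
    using assms(2) by (auto simp: temp_modes_star_def)
  also have "wave n $ 3 \<le> Max ((\<lambda>n. wave n $ 3) ` A)"
    using assms(1) n by (intro Max_ge) auto
  finally show ?thesis
    using False by (simp add: max_vertical_def)
qed (simp add: max_vertical_def)

theorem lemma3p5:
  fixes k1 k2 P :: real and Nu Nt :: "mode set"
  assumes "k1 > 0" and "k2 > 0" and "P > 0"
    and "finite Nu" and "Nu \<subseteq> vel_modes"
    and "finite Nt" and "Nt \<subseteq> temp_modes"
    and "energy_balance k1 k2 Nu Nt"
  shows "\<exists>C::real. C > 0 \<and>
    (\<forall>R S :: real. R \<ge> 0 \<longrightarrow> S \<ge> 0 \<longrightarrow>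
      Sup {nusselt k1 k2 Nu Nt u th | u0 th0 u th.
             model_solution k1 k2 P R S Nu Nt u0 th0 u th}
        \<le> ereal (C * (1 + real (card (Nt \<inter> temp_modes_star)))
                   * real (max_vertical (Nt \<inter> temp_modes_star))))"
\<comment> \<open>The constant is left open here and becomes 1 in the last estimate, which works
  because \<open>2 / pi\<close> is at most 1.\<close>
proof (intro exI conjI allI impI Sup_least)
  interpret box k1 k2
    using assms by unfold_locales
  fix R S :: real and y
  let ?c = "real (card (Nt \<inter> temp_modes_star))" and ?m = "real (max_vertical (Nt \<inter> temp_modes_star))"
  assume "y \<in> {nusselt k1 k2 Nu Nt u th | u0 th0 u th. model_solution k1 k2 P R S Nu Nt u0 th0 u th}"
  then have "y \<le> ereal (1 + 2 / pi * ?c)"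
    using nusselt_le[OF assms(4,6,7,5,8)] by auto
  also have "1 + 2 / pi * ?c \<le> 1 + 1 * ?c"
    using pi_ge_two by (intro add_left_mono mult_right_mono) auto
  also have "\<dots> \<le> 1 * (1 + ?c) * ?m"
    using max_vertical_ge_1[of "Nt \<inter> temp_modes_star"] assms mult_left_mono[of 1 ?m "1 + ?c"] by simp
  finally show "y \<le> ereal (1 * (1 + ?c) * ?m)"
    by simp
qed simp

end
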